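(* Let $0<T<1$ and $s\in\mathbb{R}$. Suppose that for some $\alpha\ge0$ there is a constant $C>0$ such that for every $\varphi\in H^s(\mathbb{R}^3)$, $$\|t^\alpha U(t)\varphi\|_{L^2_xL^\infty_{yzT}}\le C\|\varphi\|_{H^s(\mathbb{R}^3)}.$$ Then $s\ge1$.
   Context: Write $\bar{x}=(x,y,z)\in\mathbb{R}^3$ with dual Fourier variable $\bar{\xi}=(\xi,\eta,\mu)$, and let $\mathcal{F}$ be the Fourier transform in space. Let $\omega(\bar{\xi})=\xi(\xi^2+\eta^2+\mu^2)$ and $U(t)=\mathcal{F}^{-1}e^{it\omega(\bar{\xi})}\mathcal{F}$, the group of the linear equation $u_t+\Delta u_x=0$. Mixed norms: $\|u\|_{L^p_xL^q_{yzT}}=\big\|\,\|u(\cdot,x,\cdot,\cdot)\|_{L^q_{t,y,z}([0,T]\times\mathbb{R}^2)}\big\|_{L^p_x(\mathbb{R})}$. *)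

theory Defs
  imports "HOL-Analysis.Analysis" "HOL-Probability.Essential_Supremum"
begin

section \<open>Schwartz functions and tempered distributions\<close>

primrec iter_deriv ::
  "'a::euclidean_space list \<Rightarrow> ('a \<Rightarrow> complex) \<Rightarrow> 'a \<Rightarrow> complex" where
  "iter_deriv [] f = f"
| "iter_deriv (b # bs) f = (\<lambda>x. frechet_derivative (iter_deriv bs f) (at x) b)"

text \<open>Multi-indices are lists of basis vectors. Differentiability of every iterated partial
  derivative at every point makes the function smooth, so \<^const>\<open>frechet_derivative\<close> is never
  applied to a non-differentiable function.\<close>

definition schwartz :: "('a::euclidean_space \<Rightarrow> complex) set" where
  "schwartz = {f. \<forall>bs\<in>lists Basis.
     (\<forall>x. iter_deriv bs f differentiable (at x)) \<and>
     (\<forall>k::nat. bounded (range (\<lambda>x. norm x ^ k *\<^sub>R iter_deriv bs f x)))}"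

definition schwartz_seminorm ::
  "nat \<Rightarrow> 'a::euclidean_space list \<Rightarrow> ('a \<Rightarrow> complex) \<Rightarrow> real" where
  "schwartz_seminorm k bs f = (SUP x. norm x ^ k * norm (iter_deriv bs f x))"

text \<open>A distribution is an arbitrary HOL function on all \<open>'a \<Rightarrow> complex\<close>, but only its values on
  \<^const>\<open>schwartz\<close> are ever constrained or used.\<close>

type_synonym 'a distr = "('a \<Rightarrow> complex) \<Rightarrow> complex"

definition tempered_distr :: "'a::euclidean_space distr \<Rightarrow> bool" where
  "tempered_distr u \<longleftrightarrow>
     (\<forall>f\<in>schwartz. \<forall>g\<in>schwartz. u (\<lambda>x. f x + g x) = u f + u g) \<and>
     (\<forall>c. \<forall>f\<in>schwartz. u (\<lambda>x. c * f x) = c * u f) \<and>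
     (\<exists>C N. \<forall>f\<in>schwartz. norm (u f) \<le>
        C * (\<Sum>k\<le>N. \<Sum>bs | set bs \<subseteq> Basis \<and> length bs \<le> N. schwartz_seminorm k bs f))"

definition represents :: "('a::euclidean_space \<Rightarrow> complex) \<Rightarrow> 'a distr \<Rightarrow> bool" where
  "represents g u \<longleftrightarrow> g \<in> borel_measurable lborel \<and>
     (\<forall>\<psi>\<in>schwartz. integrable lborel (\<lambda>x. g x * \<psi> x) \<and> u \<psi> = (LINT x|lborel. g x * \<psi> x))"


section \<open>Fourier transform\<close>

definition fourier :: "('a::euclidean_space \<Rightarrow> complex) \<Rightarrow> 'a \<Rightarrow> complex" where
  "fourier f \<xi> =
     of_real ((2 * pi) powr (- real DIM('a) / 2)) * (LINT x|lborel. cis (- (x \<bullet> \<xi>)) * f x)"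

definition inv_fourier :: "('a::euclidean_space \<Rightarrow> complex) \<Rightarrow> 'a \<Rightarrow> complex" where
  "inv_fourier f x =
     of_real ((2 * pi) powr (- real DIM('a) / 2)) * (LINT \<xi>|lborel. cis (x \<bullet> \<xi>) * f \<xi>)"

definition fourier_distr :: "'a::euclidean_space distr \<Rightarrow> 'a distr" where
  "fourier_distr u = (\<lambda>\<psi>. u (fourier \<psi>))"

definition inv_fourier_distr :: "'a::euclidean_space distr \<Rightarrow> 'a distr" where
  "inv_fourier_distr u = (\<lambda>\<psi>. u (inv_fourier \<psi>))"

definition mult_distr :: "('a::euclidean_space \<Rightarrow> complex) \<Rightarrow> 'a distr \<Rightarrow> 'a distr" where
  "mult_distr m u = (\<lambda>\<psi>. u (\<lambda>x. m x * \<psi> x))"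


section \<open>Sobolev spaces\<close>

definition ennreal_sqrt :: "ennreal \<Rightarrow> ennreal" where
  "ennreal_sqrt a = (if a = top then top else ennreal (sqrt (enn2real a)))"

text \<open>The function representing a distribution is unique up to null sets, on which the weighted
  integral does not depend. Hence the infimum ranges over at most one value; it is \<open>top\<close> if the
  Fourier transform of \<open>u\<close> is not a function.\<close>

definition sobolev_norm :: "real \<Rightarrow> 'a::euclidean_space distr \<Rightarrow> ennreal" where
  "sobolev_norm s u = (INF g\<in>{g. represents g (fourier_distr u)}.
     ennreal_sqrt (\<integral>\<^sup>+\<xi>. ennreal ((1 + (norm \<xi>)\<^sup>2) powr s * (norm (g \<xi>))\<^sup>2) \<partial>lborel))"

definition sobolev :: "real \<Rightarrow> 'a::euclidean_space distr set" where
  "sobolev s = {u. tempered_distr u \<and> sobolev_norm s u < top}"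


section \<open>The linear group and the mixed norm\<close>

type_synonym R3 = "real \<times> real \<times> real"

definition symb :: "R3 \<Rightarrow> real" where
  "symb = (\<lambda>(\<xi>, \<eta>, \<mu>). \<xi> * (\<xi>\<^sup>2 + \<eta>\<^sup>2 + \<mu>\<^sup>2))"

definition U :: "real \<Rightarrow> R3 distr \<Rightarrow> R3 distr" where
  "U t u = inv_fourier_distr (mult_distr (\<lambda>\<zeta>. cis (t * symb \<zeta>)) (fourier_distr u))"

definition L2_Linf_norm :: "real \<Rightarrow> (real \<Rightarrow> R3 \<Rightarrow> complex) \<Rightarrow> ennreal" where
  "L2_Linf_norm T v = ennreal_sqrt (\<integral>\<^sup>+x.
     (esssup (restrict_space lborel ({0..T} \<times> UNIV))
        (\<lambda>(t, y, z). ennreal (norm (v t (x, y, z)))))\<^sup>2 \<partial>lborel)"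

text \<open>For \<open>s < 0\<close> a value of the group need not be a function, so the mixed norm is defined for
  curves of distributions: it is the norm of a jointly measurable function \<open>v\<close> with \<open>v t\<close>
  representing \<open>w t\<close> for almost all \<open>t\<close> in \<open>[0,T]\<close>, and \<open>top\<close> if there is none. Such a \<open>v\<close> is
  unique up to null sets of \<open>[0,T] \<times> \<real>\<^sup>3\<close>, so again the infimum ranges over at most one value.\<close>

definition mixed_norm :: "real \<Rightarrow> (real \<Rightarrow> R3 distr) \<Rightarrow> ennreal" where
  "mixed_norm T w = (INF v\<in>{v. (\<lambda>(t, p). v t p) \<in> borel_measurable lborel \<and>
     (AE t in lborel. t \<in> {0..T} \<longrightarrow> represents (v t) (w t))}. L2_Linf_norm T v)"

end

theory Submission
  imports Defs "HOL-Probability.Characteristic_Functions" "HOL-Probability.Sinc_Integral"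
begin

text \<open>The loss of one derivative comes from the variables \<open>y\<close> and \<open>z\<close> alone: the estimate contains the
  embedding of \<open>H\<^sup>s\<close> into \<open>L\<^sup>\<infinity>\<close> in two dimensions. To see this, take data with frequencies
  \<open>\<bar>\<eta>\<bar>, \<bar>\<mu>\<bar> \<lesssim> N\<close> and \<open>\<bar>\<xi>\<bar> \<lesssim> 1 / N\<^sup>3\<close>. There \<open>\<xi> (\<xi>\<^sup>2 + \<eta>\<^sup>2 + \<mu>\<^sup>2)\<close> is \<open>O(1 / N)\<close>, so the group is
  nearly the identity for times in \<open>[0, 1]\<close>, and for \<open>t\<close> in \<open>[T / 2, T]\<close> the factor \<open>t powr \<alpha>\<close> is bounded below. The
  solution is of unit size near \<open>y = z = 0\<close> for \<open>\<bar>x\<bar> \<lesssim> N\<^sup>3\<close>, which makes the mixed norm of order \<open>N powr (3 / 2)\<close>.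
  The solution lives in a box with sides \<open>N\<^sup>3, 1 / N, 1 / N\<close>, so its norm in \<open>H\<^sup>s\<close> is at most of order
  \<open>N powr (\<sigma> + 1 / 2)\<close> with \<open>\<sigma> = max s 0\<close>. Letting \<open>N\<close> tend to infinity gives \<open>\<sigma> \<ge> 1\<close>, that is \<open>s \<ge> 1\<close>.

  The data are anisotropic Gaussians, whose Fourier transforms are explicit (\<open>fourier_gauss\<close>). The upper bound
  for the Sobolev norm is \<open>gauss_distr_sobolev_norm\<close>. For the lower bound, the solution is paired with the
  same Gaussian as a test function: \<open>norm_U_gauss_ge\<close> bounds the pairing from below, and the duality
  inequality \<open>weighted_integral_le_L2_Linf_norm\<close> converts it into a bound for the mixed norm.\<close>

section \<open>Polynomials times Gaussians are Schwartz functions\<close>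

definition gauss :: "('a::euclidean_space \<Rightarrow> real) \<Rightarrow> 'a \<Rightarrow> real" where
  "gauss c x = exp (- (\<Sum>b\<in>Basis. (c b * (x \<bullet> b))\<^sup>2) / 2)"

lemma real_polynomial_function_has_derivative:
  assumes "real_polynomial_function p"
  shows "\<exists>p'. (\<forall>x. (p has_derivative p' x) (at x)) \<and>
              (\<forall>b. real_polynomial_function (\<lambda>x. p' x b))"
  using assms
proof (induction p)
  case (linear f)
  then show ?case
    by (intro exI[of _ "\<lambda>x. f"]) (auto intro: bounded_linear_imp_has_derivative real_polynomial_function.intros(2))
next
  case (const c)
  then show ?case
    by (intro exI[of _ "\<lambda>x b. 0"]) (auto intro: real_polynomial_function.intros(2))
next
  case (add f g)
  then obtain f' g' where "\<forall>x. (f has_derivative f' x) (at x)" "\<forall>x. (g has_derivative g' x) (at x)"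
    "\<forall>b. real_polynomial_function (\<lambda>x. f' x b)" "\<forall>b. real_polynomial_function (\<lambda>x. g' x b)"
    by blast
  then show ?case
    by (intro exI[of _ "\<lambda>x b. f' x b + g' x b"])
      (auto intro!: has_derivative_add real_polynomial_function.intros(3))
next
  case (mult f g)
  then obtain f' g' where *: "\<forall>x. (f has_derivative f' x) (at x)" "\<forall>x. (g has_derivative g' x) (at x)"
    "\<forall>b. real_polynomial_function (\<lambda>x. f' x b)" "\<forall>b. real_polynomial_function (\<lambda>x. g' x b)"
    by blast
  then show ?case
    using mult.hyps
    by (intro exI[of _ "\<lambda>x b. f x * g' x b + f' x b * g x"])
      (auto intro!: has_derivative_mult real_polynomial_function.intros(3) real_polynomial_function.intros(4))
qed

lemma real_polynomial_function_growth:
  assumes "real_polynomial_function p"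
  shows "\<exists>C m. \<forall>x. \<bar>p x\<bar> \<le> C * (1 + norm x) ^ m"
  using assms
proof (induction p)
  case (linear f)
  then obtain K where K: "0 \<le> K" "\<And>x. norm (f x) \<le> norm x * K"
    using bounded_linear.nonneg_bounded by blast
  have "\<bar>f x\<bar> \<le> K * (1 + norm x) ^ 1" for x
    using K(2)[of x] K(1) by (simp add: algebra_simps)
  then show ?case by blast
next
  case (const c)
  have "\<bar>c\<bar> \<le> \<bar>c\<bar> * (1 + norm x) ^ 0" for x :: 'a by simp
  then show ?case by blast
next
  case (add f g)
  then obtain C m D n where *: "\<And>x. \<bar>f x\<bar> \<le> C * (1 + norm x) ^ m" "\<And>x. \<bar>g x\<bar> \<le> D * (1 + norm x) ^ n"
    by blast
  have "\<bar>f x + g x\<bar> \<le> (\<bar>C\<bar> + \<bar>D\<bar>) * (1 + norm x) ^ (m + n)" for x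
  proof -
    have "(1 + norm x) ^ m \<le> (1 + norm x) ^ (m + n)" "(1 + norm x) ^ n \<le> (1 + norm x) ^ (m + n)"
      by (rule power_increasing; simp)+
    then have "C * (1 + norm x) ^ m \<le> \<bar>C\<bar> * (1 + norm x) ^ (m + n)"
      "D * (1 + norm x) ^ n \<le> \<bar>D\<bar> * (1 + norm x) ^ (m + n)"
      by (auto intro!: mult_mono)
    with *[of x] show ?thesis by (simp add: distrib_right)
  qed
  then show ?case by blast
next
  case (mult f g)
  then obtain C m D n where *: "\<And>x. \<bar>f x\<bar> \<le> C * (1 + norm x) ^ m" "\<And>x. \<bar>g x\<bar> \<le> D * (1 + norm x) ^ n"
    by blast
  have "\<bar>f x * g x\<bar> \<le> (C * D) * (1 + norm x) ^ (m + n)" for x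
  proof -
    have "\<bar>f x\<bar> * \<bar>g x\<bar> \<le> (C * (1 + norm x) ^ m) * (D * (1 + norm x) ^ n)"
      using *[of x] by (intro mult_mono) (auto intro: order_trans[OF abs_ge_zero])
    then show ?thesis by (simp add: abs_mult power_add mult_ac)
  qed
  then show ?case by blast
qed

text \<open>The Gaussian is dominated by \<open>exp (- a\<^sup>2 \<bar>x\<bar>\<^sup>2 / 2)\<close> with \<open>a\<close> the smallest scale. By Young's inequality
  \<open>1 + r \<le> K (1 + e r\<^sup>2) \<le> K exp (e r\<^sup>2)\<close>, and if \<open>e\<close> is small compared with \<open>a\<^sup>2 / m\<close>, the \<open>m\<close>-th power
  of this bound is still absorbed by the Gaussian.\<close>

lemma power_times_gauss_bounded:
  fixes c :: "'a::euclidean_space \<Rightarrow> real"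
  assumes c: "\<And>b. b \<in> Basis \<Longrightarrow> c b > 0"
  shows "\<exists>B. \<forall>x. (1 + norm x) ^ m * gauss c x \<le> B"
proof -
  define a where "a = Min (c ` Basis)"
  have a: "a > 0" "\<And>b. b \<in> Basis \<Longrightarrow> a \<le> c b"
    using c by (auto simp: a_def)
  \<comment> \<open>The summand 1 keeps the denominator positive for \<open>m = 0\<close>.\<close>
  define e where "e = a\<^sup>2 / (2 * (real m + 1))"
  have e: "e > 0" using a by (auto simp: e_def)
  have em: "real m * e \<le> a\<^sup>2 / 2"
    using a by (auto simp: e_def field_simps)
  have g: "gauss c x \<le> exp (- (a\<^sup>2 / 2 * (norm x)\<^sup>2))" for x
  proof -
    have "a\<^sup>2 * (norm x)\<^sup>2 = (\<Sum>b\<in>Basis. (a * (x \<bullet> b))\<^sup>2)"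
      by (simp add: norm_eq_sqrt_inner euclidean_inner[of x x] sum_nonneg power_mult_distrib sum_distrib_left power2_eq_square mult_ac)
    also have "\<dots> \<le> (\<Sum>b\<in>Basis. (c b * (x \<bullet> b))\<^sup>2)"
      unfolding power_mult_distrib using a
      by (intro sum_mono mult_right_mono power_mono) auto
    finally show ?thesis by (simp add: gauss_def)
  qed
  have "(1 + norm x) ^ m * gauss c x \<le> (1 + 1 / (4 * e)) ^ m" for x
  proof -
    define r where "r = norm x"
    have r: "r \<ge> 0" by (simp add: r_def)
    \<comment> \<open>Young's inequality \<open>r \<le> e r\<^sup>2 + 1 / (4 e)\<close>, as a completed square.\<close>
    have "0 \<le> (2 * e * r - 1)\<^sup>2 / (4 * e)" using e by simp
    also have "\<dots> = e * r\<^sup>2 - r + 1 / (4 * e)"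
      using e by (simp add: power2_eq_square field_simps)
    finally have "1 + r \<le> (1 + 1 / (4 * e)) + e * r\<^sup>2" by simp
    also have "\<dots> \<le> (1 + 1 / (4 * e)) * (1 + e * r\<^sup>2)"
      using e by (simp add: algebra_simps)
    also have "\<dots> \<le> (1 + 1 / (4 * e)) * exp (e * r\<^sup>2)"
      using e by (intro mult_left_mono exp_ge_add_one_self) auto
    finally have "(1 + r) ^ m \<le> ((1 + 1 / (4 * e)) * exp (e * r\<^sup>2)) ^ m"
      using r by (intro power_mono) auto
    also have "\<dots> = (1 + 1 / (4 * e)) ^ m * exp (real m * e * r\<^sup>2)"
      by (simp add: power_mult_distrib exp_of_nat_mult mult_ac flip: exp_of_nat_mult)
    also have "\<dots> \<le> (1 + 1 / (4 * e)) ^ m * exp (a\<^sup>2 / 2 * r\<^sup>2)"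
      using e mult_right_mono[OF em, of "r\<^sup>2"] by (intro mult_left_mono) auto
    finally have "(1 + r) ^ m * gauss c x \<le> ((1 + 1 / (4 * e)) ^ m * exp (a\<^sup>2 / 2 * r\<^sup>2)) * exp (- (a\<^sup>2 / 2 * r\<^sup>2))"
      using g[of x] r e by (intro mult_mono) (auto simp: r_def gauss_def)
    then show ?thesis by (simp add: r_def mult.assoc flip: exp_add)
  qed
  then show ?thesis by blast
qed

text \<open>The class of polynomials times a fixed Gaussian is closed under partial derivatives, because the
  exponent is itself a polynomial. This is what makes all iterated derivatives accessible at once.\<close>

lemma polynomial_gauss_iter_deriv:
  fixes p :: "'a::euclidean_space \<Rightarrow> real"
  assumes "real_polynomial_function p"
  shows "\<exists>p'. real_polynomial_function p' \<and>
    iter_deriv bs (\<lambda>x. complex_of_real (p x * gauss c x)) = (\<lambda>x. of_real (p' x * gauss c x))"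
proof (induction bs)
  case Nil
  then show ?case using assms by auto
next
  case (Cons b bs)
  then obtain p' where p': "real_polynomial_function p'"
    "iter_deriv bs (\<lambda>x. complex_of_real (p x * gauss c x)) = (\<lambda>x. of_real (p' x * gauss c x))"
    by blast
  let ?q = "\<lambda>x. - (\<Sum>b\<in>Basis. (c b * (x \<bullet> b))\<^sup>2) / 2"
  have q: "real_polynomial_function ?q"
    by (intro real_polynomial_function_divide real_polynomial_function_minus real_polynomial_function_sum
        real_polynomial_function_power real_polynomial_function.intros(4) real_polynomial_function.intros(2)
        real_polynomial_function.intros(1) bounded_linear_inner_left) auto
  obtain q' where q': "\<And>x. (?q has_derivative q' x) (at x)" "\<And>b. real_polynomial_function (\<lambda>x. q' x b)"
    using real_polynomial_function_has_derivative[OF q] by blast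
  obtain p'' where p'': "\<And>x. (p' has_derivative p'' x) (at x)" "\<And>b. real_polynomial_function (\<lambda>x. p'' x b)"
    using real_polynomial_function_has_derivative[OF p'(1)] by blast
  have "((\<lambda>x. complex_of_real (p' x * gauss c x)) has_derivative
     (\<lambda>b. of_real (p' x * (q' x b * exp (?q x)) + p'' x b * exp (?q x)))) (at x)" for x
    unfolding gauss_def
    by (intro has_derivative_of_real has_derivative_mult p''
        has_derivative_eq_rhs[OF has_derivative_exp[OF q'(1)]]) (simp add: fun_eq_iff)
  from frechet_derivative_at[OF this]
  have "iter_deriv (b # bs) (\<lambda>x. complex_of_real (p x * gauss c x)) =
     (\<lambda>x. of_real (p' x * (q' x b * exp (?q x)) + p'' x b * exp (?q x)))"
    unfolding iter_deriv.simps p'(2) by (auto simp only: fun_eq_iff)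
  also have "\<dots> = (\<lambda>x. of_real ((p' x * q' x b + p'' x b) * gauss c x))"
    unfolding gauss_def by (simp only: distrib_right mult.assoc)
  finally have "iter_deriv (b # bs) (\<lambda>x. complex_of_real (p x * gauss c x)) =
     (\<lambda>x. of_real ((p' x * q' x b + p'' x b) * gauss c x))" .
  moreover have "real_polynomial_function (\<lambda>x. p' x * q' x b + p'' x b)"
    by (intro real_polynomial_function.intros(3) real_polynomial_function.intros(4) p' p'' q')
  ultimately show ?case by blast
qed

lemma polynomial_gauss_schwartz:
  fixes p :: "'a::euclidean_space \<Rightarrow> real"
  assumes p: "real_polynomial_function p" and c: "\<And>b. b \<in> Basis \<Longrightarrow> c b > 0"
  shows "(\<lambda>x. complex_of_real (p x * gauss c x)) \<in> schwartz"
  unfolding schwartz_def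
proof (intro CollectI ballI conjI allI)
  fix bs :: "'a list" and x :: 'a and k :: nat
  obtain p' where p': "real_polynomial_function p'"
    "iter_deriv bs (\<lambda>x. complex_of_real (p x * gauss c x)) = (\<lambda>x. of_real (p' x * gauss c x))"
    using polynomial_gauss_iter_deriv[OF p] by blast
  have [derivative_intros]: "p' differentiable (at x)"
    by (rule differentiable_at_real_polynomial_function) fact
  have "gauss c differentiable (at x)"
    unfolding gauss_def[abs_def] differentiable_def
    by (rule exI) (auto intro!: derivative_eq_intros)
  then have "(\<lambda>x. p' x * gauss c x) differentiable (at x)"
    by (intro derivative_intros)
  then obtain D where "((\<lambda>x. p' x * gauss c x) has_derivative D) (at x)"
    unfolding differentiable_def by blast
  then have "((\<lambda>x. complex_of_real (p' x * gauss c x)) has_derivative (\<lambda>x. of_real (D x))) (at x)"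
    by (rule has_derivative_of_real)
  then show "iter_deriv bs (\<lambda>x. complex_of_real (p x * gauss c x)) differentiable at x"
    unfolding p'(2) by (rule differentiableI)
  obtain C m where C: "\<And>x. \<bar>p' x\<bar> \<le> C * (1 + norm x) ^ m"
    using real_polynomial_function_growth[OF p'(1)] by blast
  obtain B where B: "\<And>x. (1 + norm x) ^ (k + m) * gauss c x \<le> B"
    using power_times_gauss_bounded[of c "k + m", OF c] by blast
  have C0: "C \<ge> 0" using C[of 0] by simp
  have "norm (norm x ^ k *\<^sub>R complex_of_real (p' x * gauss c x)) \<le> C * B" for x
  proof -
    have "norm (norm x ^ k *\<^sub>R complex_of_real (p' x * gauss c x)) = norm x ^ k * (\<bar>p' x\<bar> * gauss c x)"
      by (simp only: norm_scaleR norm_of_real) (simp add: abs_mult gauss_def)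
    also have "\<dots> \<le> (1 + norm x) ^ k * ((C * (1 + norm x) ^ m) * gauss c x)"
      using C[of x] by (intro mult_mono power_mono) (auto simp: gauss_def)
    also have "\<dots> = C * ((1 + norm x) ^ (k + m) * gauss c x)"
      by (simp add: power_add mult_ac)
    also have "\<dots> \<le> C * B" using B[of x] C0 by (intro mult_left_mono)
    finally show ?thesis .
  qed
  then show "bounded (range (\<lambda>x. norm x ^ k *\<^sub>R iter_deriv bs (\<lambda>x. complex_of_real (p x * gauss c x)) x))"
    unfolding p'(2) bounded_iff by (intro exI[of _ "C * B"]) auto
qed

lemma gauss_schwartz:
  assumes "\<And>b. b \<in> Basis \<Longrightarrow> c b > 0"
  shows "(\<lambda>x. complex_of_real (gauss c x)) \<in> schwartz"
  using polynomial_gauss_schwartz[OF real_polynomial_function.intros(2)[of 1] assms] by simp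

section \<open>Integrability of Schwartz functions and duality for the Fourier transform\<close>

lemma schwartz_bounded:
  assumes "f \<in> schwartz"
  shows "\<exists>B. \<forall>x. norm x ^ k * norm (f x) \<le> B"
proof -
  have "\<forall>bs\<in>lists Basis. bounded (range (\<lambda>x. norm x ^ k *\<^sub>R iter_deriv bs f x))"
    using assms by (auto simp: schwartz_def)
  from this[rule_format, of "[]"] show ?thesis by (auto simp: bounded_iff)
qed

lemma schwartz_measurable [measurable_dest]:
  assumes "f \<in> schwartz"
  shows "f \<in> borel_measurable borel"
proof -
  have "\<forall>bs\<in>lists Basis. \<forall>x. iter_deriv bs f differentiable (at x)"
    using assms by (auto simp: schwartz_def)
  from this[rule_format, of "[]"] show ?thesis
    by (auto intro!: borel_measurable_continuous_onI continuous_at_imp_continuous_on differentiable_imp_continuous_within)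
qed

lemma
  fixes f :: "'a::euclidean_space \<Rightarrow> real \<Rightarrow> 'b::{real_normed_field,banach,second_countable_topology}"
  assumes "\<And>b. b \<in> Basis \<Longrightarrow> integrable lborel (f b)"
  shows integrable_lborel_prod: "integrable lborel (\<lambda>x. \<Prod>b\<in>Basis. f b (x \<bullet> b))" (is ?I)
    and integral_lborel_prod: "(LINT x|lborel. (\<Prod>b\<in>Basis. f b (x \<bullet> b))) = (\<Prod>b\<in>Basis. (LINT x|lborel. f b x))" (is ?E)
proof -
  interpret product_sigma_finite "\<lambda>_::'a. lborel :: real measure" ..
  have meas [measurable]: "\<And>b. b \<in> Basis \<Longrightarrow> f b \<in> borel_measurable borel"
    using assms by (auto dest: borel_measurable_integrable)
  have eq: "(\<Prod>b\<in>Basis. f b ((\<Sum>b\<in>Basis. g b *\<^sub>R b) \<bullet> b)) = (\<Prod>b\<in>Basis. f b (g b))" for g :: "'a \<Rightarrow> real"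
    by (intro prod.cong) simp_all
  show ?I
    using product_integrable_prod[of Basis f] assms
    by (subst lborel_eq) (auto simp: integrable_distr_eq eq)
  show ?E
    using product_integral_prod[of Basis f] assms
    by (subst lborel_eq) (auto simp: integral_distr eq)
qed

text \<open>A product of one-dimensional Cauchy densities serves as the integrable majorant: its reciprocal
  is a polynomial of degree \<open>2 n\<close>, which the decay of a Schwartz function beats.\<close>

lemma schwartz_integrable:
  fixes f :: "'a::euclidean_space \<Rightarrow> complex"
  assumes f: "f \<in> schwartz"
  shows "integrable lborel f"
proof -
  note [measurable] = schwartz_measurable[OF f]
  let ?w = "\<lambda>x::'a. \<Prod>b\<in>Basis. inverse (1 + (x \<bullet> b)\<^sup>2)"
  let ?n = "DIM('a)"
  obtain B where B: "\<And>x. norm x ^ 0 * norm (f x) \<le> B" using schwartz_bounded[OF f] by blast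
  obtain B' where B': "\<And>x. norm x ^ (2 * ?n) * norm (f x) \<le> B'" using schwartz_bounded[OF f] by blast
  have "integrable lborel (\<lambda>x::real. inverse (1 + x\<^sup>2))"
    using integrable_inverse_1_plus_square by (simp add: set_integrable_def)
  then have "integrable lborel ?w" by (rule integrable_lborel_prod)
  then have "integrable lborel (\<lambda>x. (2 ^ ?n * (B + B')) * ?w x)" by simp
  then show ?thesis
  proof (rule Bochner_Integration.integrable_bound)
    show "AE x in lborel. norm (f x) \<le> norm (2 ^ ?n * (B + B') * ?w x)"
    proof (rule AE_I2)
      fix x :: 'a
      have "(\<Prod>b\<in>Basis. 1 + (x \<bullet> b)\<^sup>2) \<le> (\<Prod>b\<in>(Basis::'a set). 1 + (norm x)\<^sup>2)"
        by (intro prod_mono) (auto simp: Basis_le_norm abs_le_square_iff[symmetric])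
      also have "\<dots> = (1 + (norm x)\<^sup>2) ^ ?n" by simp
      also have "\<dots> \<le> (2 * max 1 ((norm x)\<^sup>2)) ^ ?n"
        by (intro power_mono) auto
      also have "\<dots> \<le> 2 ^ ?n * (1 + norm x ^ (2 * ?n))"
        by (auto simp: max_def power_mult_distrib power_mult)
      finally have P: "(\<Prod>b\<in>Basis. 1 + (x \<bullet> b)\<^sup>2) \<le> 2 ^ ?n * (1 + norm x ^ (2 * ?n))" .
      have pos: "(\<Prod>b\<in>Basis. 1 + (x \<bullet> b)\<^sup>2) > 0" by (intro prod_pos) (auto intro: add_pos_nonneg)
      have w: "?w x = 1 / (\<Prod>b\<in>Basis. 1 + (x \<bullet> b)\<^sup>2)"
        by (simp add: inverse_eq_divide prod_dividef)
      have "(\<Prod>b\<in>Basis. 1 + (x \<bullet> b)\<^sup>2) * norm (f x) \<le> 2 ^ ?n * (1 + norm x ^ (2 * ?n)) * norm (f x)"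
        using P by (intro mult_right_mono) auto
      also have "\<dots> = 2 ^ ?n * (norm (f x) + norm x ^ (2 * ?n) * norm (f x))" by (simp add: algebra_simps)
      also have "\<dots> \<le> 2 ^ ?n * (B + B')" using B[of x] B'[of x] by (intro mult_left_mono add_mono) auto
      finally have "norm (f x) \<le> 2 ^ ?n * (B + B') * ?w x"
        unfolding w using pos by (simp add: pos_le_divide_eq mult.commute)
      then show "norm (f x) \<le> norm (2 ^ ?n * (B + B') * ?w x)" by simp
    qed
  qed measurable
qed

lemma polynomial_gauss_integrable:
  fixes p :: "'a::euclidean_space \<Rightarrow> real"
  assumes p: "real_polynomial_function p" and c: "\<And>b. b \<in> Basis \<Longrightarrow> c b > 0"
  shows "integrable lborel (\<lambda>x. p x * gauss c x)"
proof -
  have "integrable lborel (\<lambda>x. Re (complex_of_real (p x * gauss c x)))"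
    by (intro integrable_Re schwartz_integrable polynomial_gauss_schwartz assms)
  then show ?thesis by simp
qed

lemma integrable_mult_schwartz:
  fixes h f :: "'a::euclidean_space \<Rightarrow> complex"
  assumes h: "integrable lborel h" and f: "f \<in> schwartz"
  shows "integrable lborel (\<lambda>x. h x * f x)"
proof -
  obtain B where B: "\<And>x. norm x ^ 0 * norm (f x) \<le> B" using schwartz_bounded[OF f] by blast
  then have "B \<ge> 0" using norm_ge_zero order_trans by (metis mult_1 power_0)
  have "integrable lborel (\<lambda>x. h x * of_real B)" using h by simp
  then show ?thesis
  proof (rule Bochner_Integration.integrable_bound)
    show "(\<lambda>x. h x * f x) \<in> borel_measurable lborel"
      using borel_measurable_integrable[OF h] schwartz_measurable[OF f] by measurable
    show "AE x in lborel. norm (h x * f x) \<le> norm (h x * of_real B)"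
      using B \<open>B \<ge> 0\<close> by (auto simp: norm_mult intro!: mult_left_mono)
  qed
qed

lemma cis_measurable [measurable]: "cis \<in> borel_measurable borel"
  by (intro borel_measurable_continuous_onI continuous_intros)

lemma integrable_cis_mult:
  assumes f: "integrable M f" and [measurable]: "\<theta> \<in> borel_measurable M"
  shows "integrable M (\<lambda>x. cis (\<theta> x) * f x)"
proof (rule Bochner_Integration.integrable_bound[OF f])
  show "(\<lambda>x. cis (\<theta> x) * f x) \<in> borel_measurable M"
    using borel_measurable_integrable[OF f] by measurable
qed (simp add: norm_mult)

text \<open>Fubini's theorem moves the transform from one factor to the other. The identity is stated for
  integrable functions because it is applied to the product of the multiplier of the linear group with the
  transform of a test function.\<close>

lemma fourier_duality:
  fixes h f :: "'a::euclidean_space \<Rightarrow> complex"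
  assumes h: "integrable lborel h" and f: "integrable lborel f"
  shows "(LINT x|lborel. h x * fourier f x) = (LINT x|lborel. fourier h x * f x)"
proof -
  note [measurable] = borel_measurable_integrable[OF h] borel_measurable_integrable[OF f]
  let ?k = "complex_of_real ((2 * pi) powr (- real DIM('a) / 2))"
  let ?F = "\<lambda>(x, y). h x * (cis (- (x \<bullet> y)) * f y)"
  have "integrable (lborel \<Otimes>\<^sub>M lborel) ?F"
  proof (rule lborel_pair.Fubini_integrable)
    show "?F \<in> borel_measurable (lborel \<Otimes>\<^sub>M lborel)"
      unfolding cis_conv_exp by measurable
    show "integrable lborel (\<lambda>x. LINT y|lborel. norm (?F (x, y)))"
      using h f by (simp add: norm_mult integrable_mult_left)
    show "AE x in lborel. integrable lborel (\<lambda>y. ?F (x, y))"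
    proof (rule AE_I2)
      fix x
      have "integrable lborel (\<lambda>y. cis (- (x \<bullet> y)) * f y)"
        unfolding cis_conv_exp
        by (rule Bochner_Integration.integrable_bound[OF f]) (auto simp: norm_mult)
      then show "integrable lborel (\<lambda>y. ?F (x, y))" by simp
    qed
  qed
  then have "(LINT y|lborel. LINT x|lborel. ?F (x, y)) = (LINT x|lborel. LINT y|lborel. ?F (x, y))"
    by (intro lborel_pair.Fubini_integral) (simp add: case_prod_unfold)
  moreover have "(LINT x|lborel. h x * fourier f x) = ?k * (LINT x|lborel. LINT y|lborel. ?F (x, y))"
  proof -
    have "h x * fourier f x = ?k * (LINT y|lborel. ?F (x, y))" for x
      by (simp add: fourier_def inner_commute)
    then show ?thesis by (simp only: integral_mult_right_zero)
  qed
  moreover have "(LINT x|lborel. fourier h x * f x) = ?k * (LINT y|lborel. LINT x|lborel. ?F (x, y))"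
  proof -
    have "(LINT x|lborel. ?F (x, y)) = (LINT x|lborel. cis (- (x \<bullet> y)) * h x) * f y" for y
      by (simp add: mult_ac flip: integral_mult_left_zero)
    then show ?thesis by (simp add: fourier_def mult.assoc)
  qed
  ultimately show ?thesis by simp
qed

section \<open>Gaussians, dilations and the Fourier transform\<close>

text \<open>After rescaling, this is the characteristic function of the standard normal distribution.\<close>

lemma fourier_integral_gauss_real:
  assumes "c > 0"
  shows "(LINT x|lborel. cis (- (x * \<xi>)) * of_real (exp (- (c * x)\<^sup>2 / 2))) =
    complex_of_real (sqrt (2 * pi) / c * exp (- (\<xi> / c)\<^sup>2 / 2))"
proof -
  let ?f = "\<lambda>x. std_normal_density x *\<^sub>R iexp (- \<xi> / c * x)"
  have "complex_of_real (exp (- (\<xi> / c)\<^sup>2 / 2)) = char std_normal_distribution (- \<xi> / c)"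
    by (simp add: char_std_normal_distribution)
  also have "\<dots> = (LINT x|lborel. ?f x)"
    unfolding char_def by (subst integral_density) auto
  also have "\<dots> = c *\<^sub>R (LINT x|lborel. ?f (c * x))"
    using lborel_integral_real_affine[of c ?f 0] assms by simp
  also have "(\<lambda>x. ?f (c * x)) =
    (\<lambda>x. (1 / sqrt (2 * pi)) *\<^sub>R (cis (- (x * \<xi>)) * of_real (exp (- (c * x)\<^sup>2 / 2))))"
    using assms by (auto simp: fun_eq_iff std_normal_density_def cis_conv_exp scaleR_conv_of_real mult_ac)
  finally show ?thesis
    using assms by (simp add: scaleR_conv_of_real field_simps)
qed

lemma power2_norm_eq_sum: "(norm x)\<^sup>2 = (\<Sum>b\<in>Basis. (x \<bullet> b)\<^sup>2)"
  unfolding power2_norm_eq_inner euclidean_inner[of x x] by (simp add: power2_eq_square)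

lemma gauss_eq_prod: "gauss c x = (\<Prod>b\<in>Basis. exp (- (c b * (x \<bullet> b))\<^sup>2 / 2))"
  by (simp add: gauss_def exp_sum[symmetric] sum_negf sum_divide_distrib)

lemma gauss_pos: "gauss c x > 0"
  by (simp add: gauss_def)

lemma gauss_square: "(gauss c x)\<^sup>2 = gauss (\<lambda>b. sqrt 2 * c b) x"
  by (simp add: gauss_def power_mult_distrib sum_distrib_left[symmetric] mult.assoc flip: exp_double)

lemma gauss_measurable [measurable]: "gauss c \<in> borel_measurable borel"
  unfolding gauss_def by measurable

lemma gauss_integrable:
  assumes "\<And>b. b \<in> Basis \<Longrightarrow> c b > 0"
  shows "integrable lborel (gauss c)"
  using polynomial_gauss_integrable[OF real_polynomial_function.intros(2)[of 1] assms] by simp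

lemma gauss_integral_pos:
  assumes "\<And>b. b \<in> Basis \<Longrightarrow> c b > 0"
  shows "(LINT x|lborel. gauss c x) > 0"
proof -
  have "(LINT x|lborel. gauss c x) \<noteq> 0"
  proof
    assume "(LINT x|lborel. gauss c x) = 0"
    then have "AE x in lborel. gauss c x = 0"
      using integral_nonneg_eq_0_iff_AE[OF gauss_integrable[of c, OF assms]]
      by (simp add: gauss_pos less_imp_le)
    then have "AE x::'a in lborel. False"
      by (simp add: gauss_pos less_imp_neq[symmetric])
    then show False
      by (simp add: AE_iff_measurable[OF _ refl])
  qed
  moreover have "(LINT x|lborel. gauss c x) \<ge> 0"
    by (intro Bochner_Integration.integral_nonneg) (simp add: gauss_pos less_imp_le)
  ultimately show ?thesis by simp
qed

lemma fourier_gauss: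
  fixes c :: "'a::euclidean_space \<Rightarrow> real"
  assumes c: "\<And>b. b \<in> Basis \<Longrightarrow> c b > 0"
  shows "fourier (\<lambda>x. complex_of_real (gauss c x)) \<xi> = of_real (gauss (\<lambda>b. 1 / c b) \<xi> / (\<Prod>b\<in>Basis. c b))"
proof -
  let ?g = "\<lambda>b x. cis (- (x * (\<xi> \<bullet> b))) * complex_of_real (exp (- (c b * x)\<^sup>2 / 2))"
  have "cis (- (x \<bullet> \<xi>)) * complex_of_real (gauss c x) = (\<Prod>b\<in>Basis. ?g b (x \<bullet> b))" for x
    unfolding prod.distrib of_real_prod[symmetric] gauss_eq_prod[symmetric]
    by (simp add: cis_conv_exp euclidean_inner[of x \<xi>] exp_sum[symmetric] sum_negf sum_distrib_left)
  then have "(LINT x|lborel. cis (- (x \<bullet> \<xi>)) * complex_of_real (gauss c x)) =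
    (LINT x|lborel. (\<Prod>b\<in>Basis. ?g b (x \<bullet> b)))"
    by simp
  also have "\<dots> = (\<Prod>b\<in>Basis. (LINT x|lborel. ?g b x))"
  proof (rule integral_lborel_prod)
    fix b :: 'a assume "b \<in> Basis"
    then have "integrable lborel (gauss (\<lambda>_::real. c b))"
      by (intro gauss_integrable c)
    then show "integrable lborel (?g b)"
      by (rule Bochner_Integration.integrable_bound) (auto simp: gauss_def norm_mult cis_conv_exp)
  qed
  also have "\<dots> = (\<Prod>b\<in>Basis. of_real (sqrt (2 * pi) / c b * exp (- (1 / c b * (\<xi> \<bullet> b))\<^sup>2 / 2)))"
    using c by (intro prod.cong refl, subst fourier_integral_gauss_real) auto
  also have "\<dots> = of_real (sqrt (2 * pi) ^ DIM('a) * (gauss (\<lambda>b. 1 / c b) \<xi> / (\<Prod>b\<in>Basis. c b)))"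
    unfolding gauss_eq_prod by (simp add: prod_dividef prod.distrib)
  finally have *: "(LINT x|lborel. cis (- (x \<bullet> \<xi>)) * complex_of_real (gauss c x)) =
    of_real (sqrt (2 * pi) ^ DIM('a) * (gauss (\<lambda>b. 1 / c b) \<xi> / (\<Prod>b\<in>Basis. c b)))" .
  have "sqrt (2 * pi) ^ DIM('a) = (2 * pi) powr (real DIM('a) / 2)"
    by (simp add: powr_half_sqrt[symmetric] powr_powr flip: powr_realpow)
  then have "(2 * pi) powr (- real DIM('a) / 2) * sqrt (2 * pi) ^ DIM('a) = 1"
    by (simp flip: powr_add)
  then show ?thesis
    unfolding fourier_def * of_real_mult[symmetric] mult.assoc[symmetric] by simp
qed

lemma inv_fourier_gauss:
  fixes c :: "'a::euclidean_space \<Rightarrow> real"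
  assumes c: "\<And>b. b \<in> Basis \<Longrightarrow> c b > 0"
  shows "inv_fourier (\<lambda>x. complex_of_real (gauss c x)) \<xi> = of_real (gauss (\<lambda>b. 1 / c b) \<xi> / (\<Prod>b\<in>Basis. c b))"
proof -
  have "inv_fourier f \<xi> = fourier f (- \<xi>)" for f :: "'a \<Rightarrow> complex"
    by (simp add: inv_fourier_def fourier_def inner_commute)
  then show ?thesis
    using fourier_gauss[of c "- \<xi>", OF c] by (simp add: gauss_def)
qed

definition dilation :: "('a::euclidean_space \<Rightarrow> real) \<Rightarrow> 'a \<Rightarrow> 'a" where
  "dilation c x = (\<Sum>b\<in>Basis. (c b * (x \<bullet> b)) *\<^sub>R b)"

lemma dilation_inner [simp]: "b \<in> Basis \<Longrightarrow> dilation c x \<bullet> b = c b * (x \<bullet> b)"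
  by (simp add: dilation_def)

lemma dilation_measurable [measurable]: "dilation c \<in> borel_measurable borel"
  unfolding dilation_def by measurable

lemma gauss_dilation: "gauss c (dilation d x) = gauss (\<lambda>b. c b * d b) x"
  by (simp add: gauss_def mult.assoc)

lemma lborel_dilation:
  fixes c :: "'a::euclidean_space \<Rightarrow> real"
  assumes "\<And>b. b \<in> Basis \<Longrightarrow> c b > 0"
  shows "lborel = density (distr lborel borel (dilation c)) (\<lambda>_. ennreal (\<Prod>b\<in>Basis. c b))"
proof -
  have "(\<Prod>b\<in>Basis. \<bar>c b\<bar>) = (\<Prod>b\<in>Basis. c b)"
    using assms by (intro prod.cong) (auto simp: less_imp_le)
  moreover have "\<And>b. b \<in> Basis \<Longrightarrow> c b \<noteq> 0"
    using assms by fastforce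
  ultimately show ?thesis
    using lborel_affine_euclidean[of c 0] by (simp add: dilation_def[abs_def])
qed

lemma nn_integral_dilation:
  fixes c :: "'a::euclidean_space \<Rightarrow> real"
  assumes c: "\<And>b. b \<in> Basis \<Longrightarrow> c b > 0" and [measurable]: "f \<in> borel_measurable borel"
  shows "(\<integral>\<^sup>+x. f x \<partial>lborel) = ennreal (\<Prod>b\<in>Basis. c b) * (\<integral>\<^sup>+x. f (dilation c x) \<partial>lborel)"
  by (subst lborel_dilation[of c, OF c], assumption)
     (simp add: nn_integral_density nn_integral_distr nn_integral_cmult)

lemma integral_dilation:
  fixes c :: "'a::euclidean_space \<Rightarrow> real" and f :: "'a \<Rightarrow> 'b::{banach,second_countable_topology}"
  assumes c: "\<And>b. b \<in> Basis \<Longrightarrow> c b > 0" and [measurable]: "f \<in> borel_measurable borel"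
  shows "(LINT x|lborel. f x) = (\<Prod>b\<in>Basis. c b) *\<^sub>R (LINT x|lborel. f (dilation c x))"
  by (subst lborel_dilation[of c, OF c], assumption)
     (simp add: integral_density integral_distr prod_nonneg c less_imp_le)

section \<open>Gaussians as tempered distributions\<close>

definition gauss_distr :: "('a::euclidean_space \<Rightarrow> real) \<Rightarrow> 'a distr" where
  "gauss_distr c f = (LINT x|lborel. of_real (gauss c x) * f x)"

lemma gauss_distr_fourier:
  fixes c :: "'a::euclidean_space \<Rightarrow> real"
  assumes c: "\<And>b. b \<in> Basis \<Longrightarrow> c b > 0" and f: "integrable lborel f"
  shows "gauss_distr c (fourier f) =
    (LINT \<xi>|lborel. of_real (gauss (\<lambda>b. 1 / c b) \<xi> / (\<Prod>b\<in>Basis. c b)) * f \<xi>)"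
proof -
  have "gauss_distr c (fourier f) = (LINT \<xi>|lborel. fourier (\<lambda>x. of_real (gauss c x)) \<xi> * f \<xi>)"
    unfolding gauss_distr_def using gauss_integrable[of c, OF c] f by (intro fourier_duality) simp_all
  then show ?thesis
    by (simp only: fourier_gauss[of c, OF c])
qed

text \<open>Pairing with an integrable function is controlled by the supremum seminorm alone.\<close>

lemma gauss_distr_tempered:
  fixes c :: "'a::euclidean_space \<Rightarrow> real"
  assumes c: "\<And>b. b \<in> Basis \<Longrightarrow> c b > 0"
  shows "tempered_distr (gauss_distr c)"
  unfolding tempered_distr_def
proof (intro conjI ballI allI)
  let ?h = "\<lambda>x. complex_of_real (gauss c x)"
  have h: "integrable lborel ?h" using gauss_integrable[of c, OF c] by simp
  note int = integrable_mult_schwartz[OF h]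
  show "gauss_distr c (\<lambda>x. f x + g x) = gauss_distr c f + gauss_distr c g"
    if "f \<in> schwartz" "g \<in> schwartz" for f g
    using int[OF that(1)] int[OF that(2)] by (simp add: gauss_distr_def distrib_left)
  show "gauss_distr c (\<lambda>x. a * f x) = a * gauss_distr c f" for a f
    by (simp add: gauss_distr_def mult.left_commute[of _ a])
  have "norm (gauss_distr c f) \<le> (LINT x|lborel. gauss c x) *
     (\<Sum>k\<le>0. \<Sum>bs | set bs \<subseteq> Basis \<and> length bs \<le> 0. schwartz_seminorm k bs f)" if f: "f \<in> schwartz" for f
  proof -
    obtain B where "\<And>x. norm x ^ 0 * norm (f x) \<le> B" using schwartz_bounded[OF f] by blast
    then have bdd: "bdd_above (range (\<lambda>x. norm (f x)))" by (auto intro!: bdd_aboveI)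
    have sup: "norm (f x) \<le> (SUP x. norm (f x))" for x
      by (rule cSUP_upper[OF _ bdd]) simp
    have [simp]: "{bs. set bs \<subseteq> Basis \<and> bs = []} = {[] :: 'a list}" by auto
    have "norm (gauss_distr c f) \<le> (LINT x|lborel. norm (?h x * f x))"
      unfolding gauss_distr_def by (rule integral_norm_bound)
    also have "\<dots> \<le> (LINT x|lborel. gauss c x * (SUP x. norm (f x)))"
      using integrable_norm[OF int[OF f]] gauss_integrable[of c, OF c] sup
      by (intro integral_mono) (auto simp: norm_mult gauss_pos less_imp_le intro!: mult_left_mono)
    finally show ?thesis by (simp add: schwartz_seminorm_def)
  qed
  then show "\<exists>C N. \<forall>f\<in>schwartz. norm (gauss_distr c f) \<le>
     C * (\<Sum>k\<le>N. \<Sum>bs | set bs \<subseteq> Basis \<and> length bs \<le> N. schwartz_seminorm k bs f)"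
    by blast
qed

lemma japanese_bracket_gauss_integrable:
  "integrable lborel (\<lambda>\<xi>::'a::euclidean_space. (1 + (norm \<xi>)\<^sup>2) * gauss (\<lambda>_. sqrt 2) \<xi>)"
proof -
  have "real_polynomial_function (\<lambda>\<xi>::'a. 1 + (\<Sum>b\<in>Basis. (\<xi> \<bullet> b)\<^sup>2))"
    by (intro real_polynomial_function.intros(2,3) real_polynomial_function_sum
        real_polynomial_function_power real_polynomial_function.intros(1) bounded_linear_inner_left) simp
  then have "real_polynomial_function (\<lambda>\<xi>::'a. 1 + (norm \<xi>)\<^sup>2)"
    by (simp add: power2_norm_eq_sum)
  then show ?thesis by (rule polynomial_gauss_integrable) simp
qed

text \<open>The Fourier transform of the distribution is the function \<open>gauss (1 / c) / (\<Prod>b\<in>Basis. c b)\<close>, and the substitution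
  \<open>\<xi> = dilation c \<zeta>\<close> turns the weighted integral of its square into one against a fixed Gaussian.
  All scales being at most \<open>N\<close>, the Sobolev weight grows at most like \<open>N\<close> to the power \<open>2 \<sigma>\<close>. An exponent
  \<open>\<sigma>\<close> in \<open>[0, 1]\<close> above \<open>s\<close> covers negative \<open>s\<close> together with positive \<open>s\<close>, and it leaves as weight the polynomial \<open>1 + \<bar>\<zeta>\<bar>\<^sup>2\<close>.\<close>

lemma gauss_distr_sobolev_norm:
  fixes c :: "'a::euclidean_space \<Rightarrow> real"
  assumes c: "\<And>b. b \<in> Basis \<Longrightarrow> 0 < c b" "\<And>b. b \<in> Basis \<Longrightarrow> c b \<le> N"
    and N: "1 \<le> N" and \<sigma>: "s \<le> \<sigma>" "0 \<le> \<sigma>" "\<sigma> \<le> 1"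
  shows "sobolev_norm s (gauss_distr c) \<le> ennreal (N powr \<sigma> *
    sqrt ((LINT \<xi>::'a|lborel. (1 + (norm \<xi>)\<^sup>2) * gauss (\<lambda>_. sqrt 2) \<xi>) / (\<Prod>b\<in>Basis. c b)))"
    (is "_ \<le> ennreal (_ * sqrt (?K / ?J))")
proof -
  let ?g = "\<lambda>\<xi>. complex_of_real (gauss (\<lambda>b. 1 / c b) \<xi> / ?J)"
  have J: "?J > 0" using c by (intro prod_pos) auto
  have ic: "\<And>b. b \<in> Basis \<Longrightarrow> 1 / c b > 0" using c by simp
  have g: "integrable lborel ?g"
    unfolding of_real_divide using gauss_integrable[where c = "\<lambda>b. 1 / c b", OF ic]
    by (intro integrable_divide_zero integrable_of_real impI)
  have rep: "represents ?g (fourier_distr (gauss_distr c))"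
    unfolding represents_def
    using borel_measurable_integrable[OF g] integrable_mult_schwartz[OF g]
      gauss_distr_fourier[of c, OF c(1) schwartz_integrable]
    by (auto simp: fourier_distr_def)
  have K: "?K \<ge> 0"
    by (intro Bochner_Integration.integral_nonneg) (auto intro!: mult_nonneg_nonneg simp: gauss_pos less_imp_le)
  have pw: "(1 + (norm (dilation c \<zeta>))\<^sup>2) powr s \<le> (N powr \<sigma>)\<^sup>2 * (1 + (norm \<zeta>)\<^sup>2)" for \<zeta> :: 'a
  proof -
    have "(norm (dilation c \<zeta>))\<^sup>2 = (\<Sum>b\<in>Basis. (c b * (\<zeta> \<bullet> b))\<^sup>2)"
      by (simp add: power2_norm_eq_sum)
    also have "\<dots> \<le> (\<Sum>b\<in>Basis. (N * (\<zeta> \<bullet> b))\<^sup>2)"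
      unfolding power_mult_distrib using c
      by (intro sum_mono mult_right_mono power_mono) (auto simp: less_imp_le)
    also have "\<dots> = N\<^sup>2 * (norm \<zeta>)\<^sup>2"
      by (simp add: power2_norm_eq_sum power_mult_distrib sum_distrib_left)
    finally have "1 + (norm (dilation c \<zeta>))\<^sup>2 \<le> N\<^sup>2 * (1 + (norm \<zeta>)\<^sup>2)"
      using one_le_power[OF N, of 2] unfolding distrib_left mult_1_right by linarith
    then have "(1 + (norm (dilation c \<zeta>))\<^sup>2) powr \<sigma> \<le> (N\<^sup>2 * (1 + (norm \<zeta>)\<^sup>2)) powr \<sigma>"
      using \<sigma> by (intro powr_mono2) auto
    also have "\<dots> = (N powr \<sigma>)\<^sup>2 * (1 + (norm \<zeta>)\<^sup>2) powr \<sigma>"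
      using N by (simp add: powr_mult power2_eq_square)
    also have "\<dots> \<le> (N powr \<sigma>)\<^sup>2 * (1 + (norm \<zeta>)\<^sup>2) powr 1"
      using \<sigma> by (intro mult_left_mono powr_mono) auto
    finally have "(1 + (norm (dilation c \<zeta>))\<^sup>2) powr \<sigma> \<le> (N powr \<sigma>)\<^sup>2 * (1 + (norm \<zeta>)\<^sup>2)"
      by simp
    moreover have "(1 + (norm (dilation c \<zeta>))\<^sup>2) powr s \<le> (1 + (norm (dilation c \<zeta>))\<^sup>2) powr \<sigma>"
      using \<sigma> by (intro powr_mono) auto
    ultimately show ?thesis by linarith
  qed
  have gd: "norm (?g (dilation c \<zeta>)) = gauss (\<lambda>_. 1) \<zeta> / ?J" for \<zeta> :: 'a
  proof -
    have "gauss (\<lambda>b. 1 / c b) (dilation c \<zeta>) = gauss (\<lambda>_. 1) \<zeta>"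
      unfolding gauss_dilation gauss_def using c by (simp add: less_imp_neq[symmetric])
    then show ?thesis using J by (simp only: norm_of_real) (simp add: gauss_pos less_imp_le)
  qed
  have "(\<integral>\<^sup>+\<xi>. ennreal ((1 + (norm \<xi>)\<^sup>2) powr s * (norm (?g \<xi>))\<^sup>2) \<partial>lborel) =
    ennreal ?J * (\<integral>\<^sup>+\<zeta>. ennreal ((1 + (norm (dilation c \<zeta>))\<^sup>2) powr s * (norm (?g (dilation c \<zeta>)))\<^sup>2) \<partial>lborel)"
    by (rule nn_integral_dilation[of c, OF c(1)]) measurable
  also have "\<dots> \<le> ennreal ?J * (\<integral>\<^sup>+\<zeta>. ennreal ((N powr \<sigma>)\<^sup>2 / ?J\<^sup>2 * ((1 + (norm (\<zeta>::'a))\<^sup>2) * gauss (\<lambda>_. sqrt 2) \<zeta>)) \<partial>lborel)"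
  proof (rule mult_left_mono[OF nn_integral_mono])
    fix \<zeta> :: 'a
    have "(1 + (norm (dilation c \<zeta>))\<^sup>2) powr s * (norm (?g (dilation c \<zeta>)))\<^sup>2 \<le>
      ((N powr \<sigma>)\<^sup>2 * (1 + (norm \<zeta>)\<^sup>2)) * (gauss (\<lambda>_. 1) \<zeta> / ?J)\<^sup>2"
      unfolding gd by (intro mult_right_mono pw) auto
    then have "(1 + (norm (dilation c \<zeta>))\<^sup>2) powr s * (norm (?g (dilation c \<zeta>)))\<^sup>2 \<le>
      (N powr \<sigma>)\<^sup>2 / ?J\<^sup>2 * ((1 + (norm \<zeta>)\<^sup>2) * gauss (\<lambda>_. sqrt 2) \<zeta>)"
      by (simp add: power_divide gauss_square)
    then show "ennreal ((1 + (norm (dilation c \<zeta>))\<^sup>2) powr s * (norm (?g (dilation c \<zeta>)))\<^sup>2) \<le>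
      ennreal ((N powr \<sigma>)\<^sup>2 / ?J\<^sup>2 * ((1 + (norm \<zeta>)\<^sup>2) * gauss (\<lambda>_. sqrt 2) \<zeta>))"
      by (rule ennreal_leI)
  qed simp
  also have "\<dots> = ennreal ?J * ennreal ((N powr \<sigma>)\<^sup>2 / ?J\<^sup>2 * ?K)"
    by (subst nn_integral_eq_integral)
       (auto intro!: japanese_bracket_gauss_integrable mult_nonneg_nonneg simp: gauss_pos less_imp_le)
  also have "\<dots> = ennreal ((N powr \<sigma>)\<^sup>2 * (?K / ?J))"
    using J K by (subst ennreal_mult[symmetric]) (auto simp: power2_eq_square)
  finally have le: "(\<integral>\<^sup>+\<xi>. ennreal ((1 + (norm \<xi>)\<^sup>2) powr s * (norm (?g \<xi>))\<^sup>2) \<partial>lborel) \<le>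
    ennreal ((N powr \<sigma>)\<^sup>2 * (?K / ?J))" (is "?L \<le> _") .
  have "sobolev_norm s (gauss_distr c) \<le> ennreal_sqrt ?L"
    unfolding sobolev_norm_def using rep by (intro INF_lower) simp
  also have "\<dots> = ennreal (sqrt (enn2real ?L))"
    using le by (auto simp: ennreal_sqrt_def top_unique)
  also have "\<dots> \<le> ennreal (sqrt ((N powr \<sigma>)\<^sup>2 * (?K / ?J)))"
    using J K by (intro ennreal_leI real_sqrt_le_mono enn2real_leI le) auto
  also have "\<dots> = ennreal (N powr \<sigma> * sqrt (?K / ?J))"
    unfolding real_sqrt_mult by simp
  finally show ?thesis .
qed

section \<open>Testing the mixed norm against separated weights\<close>

lemma borel_measurable_fst_borel [measurable]:
  "fst \<in> borel_measurable (borel :: ('a::second_countable_topology \<times> 'b::second_countable_topology) measure)"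
  by (intro borel_measurable_continuous_onI continuous_intros)

lemma borel_measurable_snd_borel [measurable]:
  "snd \<in> borel_measurable (borel :: ('a::second_countable_topology \<times> 'b::second_countable_topology) measure)"
  by (intro borel_measurable_continuous_onI continuous_intros)

lemma ennreal_sqrt_power2: "(ennreal_sqrt a)\<^sup>2 = a"
  by (cases a) (auto simp: ennreal_sqrt_def ennreal_power power2_eq_square ennreal_mult_top simp flip: ennreal_mult)

lemma nn_integral_lborel_pair:
  fixes f :: "'a::euclidean_space \<times> 'b::euclidean_space \<Rightarrow> ennreal"
  assumes [measurable]: "f \<in> borel_measurable borel"
  shows "(\<integral>\<^sup>+w. f w \<partial>lborel) = (\<integral>\<^sup>+x. \<integral>\<^sup>+y. f (x, y) \<partial>lborel \<partial>lborel)"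
  unfolding lborel_prod[symmetric]
  by (subst lborel.nn_integral_fst[symmetric]) (simp_all add: lborel_prod)

text \<open>This is the duality inequality between \<open>L\<^sup>2\<^sub>x L\<^sup>\<infinity>\<close> and \<open>L\<^sup>2\<^sub>x L\<^sup>1\<close>, for weights that separate the
  variables \<open>t\<close>, \<open>x\<close> and \<open>(y, z)\<close>: for fixed \<open>x\<close> the integral over \<open>(t, y, z)\<close> is at most \<open>k\<close> times the
  essential supremum, and the Cauchy-Schwarz inequality handles the integral in \<open>x\<close>. The constant \<open>k\<close>
  is taken out of the integral of the averages \<open>m x\<close>, which are measurable in \<open>x\<close> by Tonelli's theorem.\<close>

lemma weighted_integral_le_L2_Linf_norm:
  fixes v :: "real \<Rightarrow> R3 \<Rightarrow> complex" and \<rho>0 \<rho>1 :: "real \<Rightarrow> ennreal" and \<rho>2 :: "real \<times> real \<Rightarrow> ennreal"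
  assumes v: "(\<lambda>(t, p). v t p) \<in> borel_measurable lborel"
    and supp: "\<And>t. t \<notin> {0..T} \<Longrightarrow> \<rho>0 t = 0"
    and [measurable]: "\<rho>0 \<in> borel_measurable borel" "\<rho>1 \<in> borel_measurable borel" "\<rho>2 \<in> borel_measurable borel"
    and k: "(\<integral>\<^sup>+t. \<rho>0 t \<partial>lborel) * (\<integral>\<^sup>+q. \<rho>2 q \<partial>lborel) = ennreal k" "k > 0"
  shows "(\<integral>\<^sup>+t. \<rho>0 t * (\<integral>\<^sup>+p. ennreal (norm (v t p)) * (\<rho>1 (fst p) * \<rho>2 (snd p)) \<partial>lborel) \<partial>lborel)\<^sup>2
    \<le> (\<integral>\<^sup>+x. (\<rho>1 x)\<^sup>2 \<partial>lborel) * (ennreal k * L2_Linf_norm T v)\<^sup>2"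
proof -
  define V where "V = (\<lambda>w. ennreal (norm (case w of (t, p) \<Rightarrow> v t p)))"
  have V [measurable]: "V \<in> borel_measurable borel"
    using v unfolding V_def by measurable
  have Vv: "ennreal (norm (v t p)) = V (t, p)" for t p by (simp add: V_def)
  have [measurable]: "(\<lambda>w. V (fst w, x, snd w)) \<in> borel_measurable borel" for x
    by (rule measurable_compose[OF _ V]) (auto intro!: borel_measurable_continuous_onI continuous_intros)
  have [measurable]: "(\<lambda>u. V (fst (snd u), fst u, snd (snd u))) \<in> borel_measurable (lborel \<Otimes>\<^sub>M lborel)"
    unfolding lborel_prod
    by (rule measurable_compose[OF _ V]) (auto intro!: borel_measurable_continuous_onI continuous_intros)
  have [measurable]: "(\<lambda>u. V (fst (fst u), snd (fst u), snd u)) \<in> borel_measurable (borel \<Otimes>\<^sub>M borel)"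
    unfolding borel_prod
    by (rule measurable_compose[OF _ V]) (auto intro!: borel_measurable_continuous_onI continuous_intros)
  let ?M = "\<lambda>x. esssup (restrict_space lborel ({0..T} \<times> UNIV)) (\<lambda>(t, y, z). ennreal (norm (v t (x, y, z))))"
  define m where "m x = (\<integral>\<^sup>+w. \<rho>0 (fst w) * (V (fst w, x, snd w) * \<rho>2 (snd w)) \<partial>lborel)" for x
  have m_meas [measurable]: "m \<in> borel_measurable lborel"
    unfolding m_def by measurable
  have m: "m x = (\<integral>\<^sup>+t. \<integral>\<^sup>+q. \<rho>0 t * (V (t, x, q) * \<rho>2 q) \<partial>lborel \<partial>lborel)" for x
    unfolding m_def by (subst nn_integral_lborel_pair, (measurable)[1]) simp
  have m_le: "m x \<le> ennreal k * ?M x" for x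
  proof -
    have "AE w in restrict_space lborel ({0..T} \<times> UNIV).
       (case w of (t, y, z) \<Rightarrow> ennreal (norm (v t (x, y, z)))) \<le> ?M x"
      by (rule esssup_AE)
    then have "AE w in lborel. w \<in> {0..T} \<times> UNIV \<longrightarrow> V (fst w, x, snd w) \<le> ?M x"
      by (subst (asm) AE_restrict_space_iff) (auto simp: V_def case_prod_unfold closed_Times borel_closed)
    then have "m x \<le> (\<integral>\<^sup>+w. ?M x * (\<rho>0 (fst w) * \<rho>2 (snd w)) \<partial>lborel)"
      unfolding m_def
    proof (intro nn_integral_mono_AE, eventually_elim)
      case (elim w)
      then show ?case using supp[of "fst w"]
        by (cases "fst w \<in> {0..T}") (auto simp: mem_Times_iff mult.left_commute intro!: mult_left_mono mult_right_mono)
    qed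
    also have "\<dots> = ?M x * (\<integral>\<^sup>+w. \<rho>0 (fst w) * \<rho>2 (snd w) \<partial>lborel)"
      by (rule nn_integral_cmult) measurable
    also have "(\<integral>\<^sup>+w. \<rho>0 (fst w) * \<rho>2 (snd w) \<partial>lborel) = ennreal k"
      unfolding k(1)[symmetric]
      by (subst nn_integral_lborel_pair, (measurable)[1]) (simp add: nn_integral_cmult nn_integral_multc)
    finally show ?thesis unfolding mult.commute[of "ennreal k"] .
  qed
  have "(\<integral>\<^sup>+t. \<rho>0 t * (\<integral>\<^sup>+p. ennreal (norm (v t p)) * (\<rho>1 (fst p) * \<rho>2 (snd p)) \<partial>lborel) \<partial>lborel)
    = (\<integral>\<^sup>+t. \<integral>\<^sup>+x. \<rho>1 x * (\<integral>\<^sup>+q. \<rho>0 t * (V (t, x, q) * \<rho>2 q) \<partial>lborel) \<partial>lborel \<partial>lborel)"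
  proof (rule nn_integral_cong)
    fix t :: real
    have "(\<integral>\<^sup>+p. ennreal (norm (v t p)) * (\<rho>1 (fst p) * \<rho>2 (snd p)) \<partial>lborel)
      = (\<integral>\<^sup>+x. \<integral>\<^sup>+q. V (t, x, q) * (\<rho>1 x * \<rho>2 q) \<partial>lborel \<partial>lborel)"
      unfolding Vv by (subst nn_integral_lborel_pair, (measurable)[1]) simp
    also have "\<dots> = (\<integral>\<^sup>+x. \<rho>1 x * (\<integral>\<^sup>+q. V (t, x, q) * \<rho>2 q \<partial>lborel) \<partial>lborel)"
      by (simp add: nn_integral_cmult[symmetric] mult.left_commute)
    finally show "\<rho>0 t * (\<integral>\<^sup>+p. ennreal (norm (v t p)) * (\<rho>1 (fst p) * \<rho>2 (snd p)) \<partial>lborel) =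
      (\<integral>\<^sup>+x. \<rho>1 x * (\<integral>\<^sup>+q. \<rho>0 t * (V (t, x, q) * \<rho>2 q) \<partial>lborel) \<partial>lborel)"
      by (simp add: nn_integral_cmult[symmetric] mult.left_commute)
  qed
  also have "\<dots> = (\<integral>\<^sup>+x. \<integral>\<^sup>+t. \<rho>1 x * (\<integral>\<^sup>+q. \<rho>0 t * (V (t, x, q) * \<rho>2 q) \<partial>lborel) \<partial>lborel \<partial>lborel)"
    by (rule lborel_pair.Fubini') measurable
  also have "\<dots> = (\<integral>\<^sup>+x. \<rho>1 x * m x \<partial>lborel)"
    unfolding m by (intro nn_integral_cong nn_integral_cmult) measurable
  finally have "(\<integral>\<^sup>+t. \<rho>0 t * (\<integral>\<^sup>+p. ennreal (norm (v t p)) * (\<rho>1 (fst p) * \<rho>2 (snd p)) \<partial>lborel) \<partial>lborel)\<^sup>2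
    = (\<integral>\<^sup>+x. \<rho>1 x * m x \<partial>lborel)\<^sup>2" by simp
  also have "\<dots> \<le> (\<integral>\<^sup>+x. (\<rho>1 x)\<^sup>2 \<partial>lborel) * (\<integral>\<^sup>+x. (m x)\<^sup>2 \<partial>lborel)"
    by (rule Cauchy_Schwarz_nn_integral) measurable
  also have "(\<integral>\<^sup>+x. (m x)\<^sup>2 \<partial>lborel) \<le> (ennreal k * L2_Linf_norm T v)\<^sup>2"
  proof -
    have inv: "ennreal k * ennreal (1 / k) = 1"
      using k(2) by (simp flip: ennreal_mult)
    have "ennreal (1 / k) * m x \<le> ?M x" for x
      using mult_left_mono[OF m_le[of x], of "ennreal (1 / k)"]
      by (simp add: mult.assoc[symmetric] inv mult.commute[of "ennreal (1 / k)"])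
    then have "(\<integral>\<^sup>+x. (ennreal (1 / k) * m x)\<^sup>2 \<partial>lborel) \<le> (L2_Linf_norm T v)\<^sup>2"
      unfolding L2_Linf_norm_def ennreal_sqrt_power2
      by (intro nn_integral_mono power_mono) simp_all
    then have "(ennreal k)\<^sup>2 * (\<integral>\<^sup>+x. (ennreal (1 / k) * m x)\<^sup>2 \<partial>lborel) \<le> (ennreal k)\<^sup>2 * (L2_Linf_norm T v)\<^sup>2"
      by (rule mult_left_mono) simp
    moreover have "(ennreal k)\<^sup>2 * (\<integral>\<^sup>+x. (ennreal (1 / k) * m x)\<^sup>2 \<partial>lborel) = (\<integral>\<^sup>+x. (m x)\<^sup>2 \<partial>lborel)"
      by (subst nn_integral_cmult[symmetric]) (simp_all add: power_mult_distrib[symmetric] mult.assoc[symmetric] inv)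
    ultimately show ?thesis by (simp add: power_mult_distrib)
  qed
  finally show ?thesis by (simp add: mult_left_mono)
qed

section \<open>The linear group on anisotropic Gaussians\<close>

text \<open>Moving both Fourier transforms onto the Gaussians makes the pairing an oscillatory integral with
  phase \<open>t symb\<close>; in the variable \<open>\<zeta>\<close> with \<open>\<xi> = dilation c \<zeta>\<close> the amplitude no longer depends on \<open>c\<close>. The square of
  \<open>gauss (\<lambda>_. 1)\<close> appears as \<open>gauss (\<lambda>_. sqrt 2)\<close>.\<close>

lemma U_gauss_distr_gauss:
  fixes c :: "R3 \<Rightarrow> real"
  assumes c: "\<And>b. b \<in> Basis \<Longrightarrow> c b > 0"
  shows "U t (gauss_distr c) (\<lambda>x. of_real (gauss c x)) =
    (LINT \<zeta>|lborel. cis (t * symb (dilation c \<zeta>)) * of_real (gauss (\<lambda>_. sqrt 2) \<zeta>)) / of_real (\<Prod>b\<in>Basis. c b)"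
proof -
  let ?J = "\<Prod>b\<in>Basis. c b"
  let ?g = "\<lambda>\<xi>. complex_of_real (gauss (\<lambda>b. 1 / c b) \<xi> / ?J)"
  have J: "?J > 0" using c by (intro prod_pos) auto
  have ic: "\<And>b. b \<in> Basis \<Longrightarrow> 1 / c b > 0" using c by simp
  have [measurable]: "symb \<in> borel_measurable borel"
    unfolding symb_def case_prod_unfold by (intro borel_measurable_continuous_onI continuous_intros)
  have g: "integrable lborel ?g"
    unfolding of_real_divide using gauss_integrable[where c = "\<lambda>b. 1 / c b", OF ic]
    by (intro integrable_divide_zero integrable_of_real impI)
  have mg: "integrable lborel (\<lambda>\<xi>. cis (t * symb \<xi>) * ?g \<xi>)"
    by (rule integrable_cis_mult[OF g]) measurable
  have "U t (gauss_distr c) (\<lambda>x. of_real (gauss c x)) = gauss_distr c (fourier (\<lambda>\<xi>. cis (t * symb \<xi>) * ?g \<xi>))"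
    by (simp only: U_def inv_fourier_distr_def mult_distr_def fourier_distr_def inv_fourier_gauss[of c, OF c])
  also have "\<dots> = (LINT \<xi>|lborel. ?g \<xi> * (cis (t * symb \<xi>) * ?g \<xi>))"
    by (rule gauss_distr_fourier[of c, OF c mg])
  also have "\<dots> = ?J *\<^sub>R (LINT \<zeta>|lborel. ?g (dilation c \<zeta>) * (cis (t * symb (dilation c \<zeta>)) * ?g (dilation c \<zeta>)))"
    by (rule integral_dilation[of c, OF c]) measurable
  also have "(\<lambda>\<zeta>. ?g (dilation c \<zeta>) * (cis (t * symb (dilation c \<zeta>)) * ?g (dilation c \<zeta>))) =
    (\<lambda>\<zeta>. (cis (t * symb (dilation c \<zeta>)) * of_real (gauss (\<lambda>_. sqrt 2) \<zeta>)) / (of_real ?J)\<^sup>2)"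
  proof (rule ext)
    fix \<zeta> :: R3
    have "gauss (\<lambda>b. 1 / c b) (dilation c \<zeta>) = gauss (\<lambda>_. 1) \<zeta>"
      unfolding gauss_dilation gauss_def using c by (simp add: less_imp_neq[symmetric])
    moreover have "complex_of_real (gauss (\<lambda>_. sqrt 2) \<zeta>) = (of_real (gauss (\<lambda>_. 1) \<zeta>))\<^sup>2"
      unfolding of_real_power[symmetric] gauss_square by simp
    ultimately show "?g (dilation c \<zeta>) * (cis (t * symb (dilation c \<zeta>)) * ?g (dilation c \<zeta>)) =
      (cis (t * symb (dilation c \<zeta>)) * of_real (gauss (\<lambda>_. sqrt 2) \<zeta>)) / (of_real ?J)\<^sup>2"
      by (simp only: of_real_divide) (simp add: power2_eq_square)
  qed
  finally show ?thesis
    using J by (simp only: integral_divide_zero) (simp add: scaleR_conv_of_real power2_eq_square)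
qed

text \<open>The frequency scales: \<open>N\<close> in \<open>\<eta>\<close> and \<open>\<mu>\<close>, but \<open>1 / N\<^sup>3\<close> in \<open>\<xi>\<close>. The symbol is of size \<open>\<xi> N\<^sup>2\<close> there, so any
  \<open>\<xi>\<close>-scale that is small compared with \<open>1 / N\<^sup>2\<close> keeps the phase of the group close to zero.\<close>

definition anisotropy :: "real \<Rightarrow> R3 \<Rightarrow> real" where
  "anisotropy N b = (if b = (1, 0, 0) then 1 / N ^ 3 else N)"

lemma Basis_R3: "(Basis :: R3 set) = {(1, 0, 0), (0, 1, 0), (0, 0, 1)}"
  by (auto simp: Basis_prod_def zero_prod_def)

lemma Basis_R2: "(Basis :: (real \<times> real) set) = {(1, 0), (0, 1)}"
  by (auto simp: Basis_prod_def zero_prod_def)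

lemma anisotropy_pos: "N > 0 \<Longrightarrow> anisotropy N b > 0"
  by (simp add: anisotropy_def)

lemma anisotropy_le: 
  assumes "N \<ge> 1"
  shows "anisotropy N b \<le> N"
proof -
  have "1 / N ^ 3 \<le> 1" using one_le_power[OF assms, of 3] assms by simp
  also note assms
  finally have "1 / N ^ 3 \<le> N" .
  then show ?thesis unfolding anisotropy_def by (cases "b = (1, 0, 0)") (simp_all only: if_True if_False simp_thms order_refl)
qed

lemma prod_anisotropy: "N > 0 \<Longrightarrow> (\<Prod>b\<in>Basis. anisotropy N b) = 1 / N"
  by (simp add: Basis_R3 anisotropy_def power3_eq_cube)

lemma dilation_anisotropy: "dilation (anisotropy N) (x, y, z) = (x / N ^ 3, N * y, N * z)"
  by (simp add: dilation_def Basis_R3 anisotropy_def)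

lemma gauss_anisotropy: "gauss (anisotropy N) (x, q) = gauss (\<lambda>_. 1 / N ^ 3) x * gauss (\<lambda>_. N) q"
  by (cases q) (simp add: gauss_def Basis_R3 Basis_R2 anisotropy_def flip: exp_add)

lemma symb_anisotropy_le:
  assumes "N \<ge> 1"
  shows "\<bar>symb (dilation (anisotropy N) \<zeta>)\<bar> \<le> \<bar>symb \<zeta>\<bar> / N"
proof (cases \<zeta>)
  case (fields x y z)
  have "(x / N ^ 3)\<^sup>2 \<le> (N * x)\<^sup>2"
  proof -
    have "\<bar>x / N ^ 3\<bar> \<le> \<bar>x\<bar>"
      using mult_left_mono[OF one_le_power[OF assms, of 3], of "\<bar>x\<bar>"] assms by (simp add: field_simps)
    also have "\<dots> \<le> \<bar>N * x\<bar>" using assms by (simp add: abs_mult mult_le_cancel_right1)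
    finally show ?thesis by (simp only: abs_le_square_iff)
  qed
  then have "(x / N ^ 3)\<^sup>2 + (N * y)\<^sup>2 + (N * z)\<^sup>2 \<le> N\<^sup>2 * (x\<^sup>2 + y\<^sup>2 + z\<^sup>2)"
    by (simp add: power_mult_distrib distrib_left)
  then have "\<bar>x / N ^ 3\<bar> * ((x / N ^ 3)\<^sup>2 + (N * y)\<^sup>2 + (N * z)\<^sup>2) \<le> \<bar>x / N ^ 3\<bar> * (N\<^sup>2 * (x\<^sup>2 + y\<^sup>2 + z\<^sup>2))"
    by (intro mult_left_mono) auto
  also have "\<dots> = \<bar>x\<bar> * (x\<^sup>2 + y\<^sup>2 + z\<^sup>2) / N"
    using assms by (simp add: power3_eq_cube power2_eq_square field_simps)
  finally show ?thesis
    by (simp add: fields dilation_anisotropy symb_def abs_mult)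
qed

lemma symb_gauss_integrable: "integrable lborel (\<lambda>\<zeta>. \<bar>symb \<zeta>\<bar> * gauss (\<lambda>_. sqrt 2) \<zeta>)"
proof -
  have lin: "bounded_linear (\<lambda>p::R3. fst p)" "bounded_linear (\<lambda>p::R3. fst (snd p))" "bounded_linear (\<lambda>p::R3. snd (snd p))"
    by (intro bounded_linear_intros bounded_linear_fst bounded_linear_snd
        bounded_linear_compose[OF bounded_linear_fst] bounded_linear_compose[OF bounded_linear_snd])+
  have "real_polynomial_function symb"
    unfolding symb_def case_prod_unfold
    by (intro real_polynomial_function.intros(3,4) real_polynomial_function_power real_polynomial_function.intros(1) lin)
  then have "integrable lborel (\<lambda>\<zeta>. symb \<zeta> * gauss (\<lambda>_. sqrt 2) \<zeta>)"
    by (rule polynomial_gauss_integrable) simp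
  then have "integrable lborel (\<lambda>\<zeta>. \<bar>symb \<zeta> * gauss (\<lambda>_. sqrt 2) \<zeta>\<bar>)"
    by (rule integrable_abs)
  then show ?thesis by (simp add: abs_mult gauss_pos less_imp_le)
qed

text \<open>The phase is at most \<open>\<bar>symb \<zeta>\<bar> / N\<close> in absolute value for times in \<open>[0, 1]\<close>, so the group changes the pairing only
  by a relative error of order \<open>1 / N\<close>.\<close>

lemma norm_U_gauss_ge:
  assumes N: "N \<ge> 1" and t: "0 \<le> t" "t \<le> 1"
  shows "N * ((LINT \<zeta>|lborel. gauss (\<lambda>_. sqrt 2) (\<zeta>::R3)) - (LINT \<zeta>|lborel. \<bar>symb \<zeta>\<bar> * gauss (\<lambda>_. sqrt 2) \<zeta>) / N)
    \<le> norm (U t (gauss_distr (anisotropy N)) (\<lambda>x. of_real (gauss (anisotropy N) x)))"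
    (is "N * (?K0 - ?K1 / N) \<le> _")
proof -
  let ?w = "gauss (\<lambda>_. sqrt 2) :: R3 \<Rightarrow> real"
  let ?f = "\<lambda>\<zeta>. cis (t * symb (dilation (anisotropy N) \<zeta>)) * of_real (?w \<zeta>)"
  have [measurable]: "symb \<in> borel_measurable borel"
    unfolding symb_def case_prod_unfold by (intro borel_measurable_continuous_onI continuous_intros)
  have w: "integrable lborel ?w" by (rule gauss_integrable) simp
  have f: "integrable lborel ?f"
    by (rule integrable_cis_mult) (use w in simp_all)
  have "?K0 - ?K1 / N = (LINT \<zeta>|lborel. ?w \<zeta> - \<bar>symb \<zeta>\<bar> * ?w \<zeta> / N)"
    using w symb_gauss_integrable by simp
  also have "\<dots> \<le> (LINT \<zeta>|lborel. Re (?f \<zeta>))"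
  proof (rule integral_mono)
    show "integrable lborel (\<lambda>\<zeta>. ?w \<zeta> - \<bar>symb \<zeta>\<bar> * ?w \<zeta> / N)" using w symb_gauss_integrable by simp
    show "integrable lborel (\<lambda>\<zeta>. Re (?f \<zeta>))" using f by (rule integrable_Re)
    fix \<zeta> :: R3
    let ?\<theta> = "t * symb (dilation (anisotropy N) \<zeta>)"
    have "\<bar>?\<theta>\<bar> \<le> 1 * \<bar>symb (dilation (anisotropy N) \<zeta>)\<bar>"
      unfolding abs_mult using t by (intro mult_right_mono) auto
    then have "\<bar>?\<theta>\<bar> \<le> \<bar>symb \<zeta>\<bar> / N"
      using symb_anisotropy_le[OF N, of \<zeta>] by linarith
    moreover have "1 - \<bar>?\<theta>\<bar> \<le> cos ?\<theta>"
    proof -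
      have "cos ?\<theta> = 1 - 2 * \<bar>sin (?\<theta> / 2)\<bar> * \<bar>sin (?\<theta> / 2)\<bar>"
        using cos_double_sin[of "?\<theta> / 2"] by (simp add: power2_eq_square)
      moreover have "2 * \<bar>sin (?\<theta> / 2)\<bar> * \<bar>sin (?\<theta> / 2)\<bar> \<le> \<bar>?\<theta>\<bar> * 1"
        using abs_sin_x_le_abs_x[of "?\<theta> / 2"] by (intro mult_mono) auto
      ultimately show ?thesis by simp
    qed
    ultimately have "(1 - \<bar>symb \<zeta>\<bar> / N) * ?w \<zeta> \<le> cos ?\<theta> * ?w \<zeta>"
      by (intro mult_right_mono) (auto simp: gauss_pos less_imp_le)
    then show "?w \<zeta> - \<bar>symb \<zeta>\<bar> * ?w \<zeta> / N \<le> Re (?f \<zeta>)"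
      by (simp add: left_diff_distrib)
  qed
  also have "\<dots> = Re (integral\<^sup>L lborel ?f)"
    using f by (rule integral_Re)
  also have "\<dots> \<le> norm (integral\<^sup>L lborel ?f)"
    by (rule complex_Re_le_cmod)
  finally have "N * (?K0 - ?K1 / N) \<le> N * norm (integral\<^sup>L lborel ?f)"
    using N by (intro mult_left_mono) auto
  also have "\<dots> = norm (U t (gauss_distr (anisotropy N)) (\<lambda>x. of_real (gauss (anisotropy N) x)))"
    using N by (subst U_gauss_distr_gauss) (auto simp: anisotropy_pos prod_anisotropy norm_divide norm_mult)
  finally show ?thesis .
qed

lemma ennreal_le_of_square_le:
  assumes le: "(ennreal a)\<^sup>2 \<le> ennreal r * (ennreal k * L)\<^sup>2" and pos: "a \<ge> 0" "r > 0" "k > 0"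
  shows "ennreal (a / (sqrt r * k)) \<le> L"
proof (cases L)
  case (real l)
  have "ennreal (a\<^sup>2) \<le> ennreal (r * (k * l)\<^sup>2)"
    using le pos real by (simp add: ennreal_power flip: ennreal_mult)
  then have "a\<^sup>2 \<le> (sqrt r * k * l)\<^sup>2"
    using pos real by (simp add: power_mult_distrib mult.assoc)
  then have "a \<le> sqrt r * k * l"
    by (rule power2_le_imp_le) (use pos real in simp)
  then show ?thesis
    using pos real by (simp add: pos_divide_le_eq mult_ac)
qed simp

text \<open>The Gaussian is tested against itself, with times restricted to \<open>[T / 2, T]\<close>, where the factor
  \<open>t powr \<alpha>\<close> is bounded below. Only the pairing with this single test function is used, hence the bound holds
  for every function \<open>v\<close> that represents the solution. Powers of \<open>N\<close>: the pairing has size \<open>N\<close>; the weight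
  has \<open>L\<^sup>2\<close> norm of order \<open>N powr (3 / 2)\<close> in \<open>x\<close> and \<open>L\<^sup>1\<close> norm of order \<open>1 / N\<^sup>2\<close> in \<open>(y, z)\<close>. The quotient is of order
  \<open>N powr (3 / 2)\<close>.\<close>

lemma mixed_norm_U_gauss_ge:
  assumes T: "0 < T" "T < 1" and \<alpha>: "\<alpha> \<ge> 0" and N: "N \<ge> 1"
  shows "ennreal ((T / 2) powr \<alpha> * N * ((LINT \<zeta>|lborel. gauss (\<lambda>_. sqrt 2) (\<zeta>::R3)) - (LINT \<zeta>|lborel. \<bar>symb \<zeta>\<bar> * gauss (\<lambda>_. sqrt 2) \<zeta>) / N)
      * sqrt N / (sqrt (LINT x|lborel. gauss (\<lambda>_. sqrt 2) (x::real)) * (LINT q|lborel. gauss (\<lambda>_. 1) (q::real \<times> real))))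
    \<le> mixed_norm T (\<lambda>t \<psi>. of_real (t powr \<alpha>) * U t (gauss_distr (anisotropy N)) \<psi>)"
    (is "ennreal (?W * sqrt N / (sqrt ?R1 * ?R2)) \<le> mixed_norm T ?w")
proof (cases "?W \<ge> 0")
  case W: True
  let ?\<psi> = "gauss (anisotropy N)"
  define \<rho>0 :: "real \<Rightarrow> ennreal" where "\<rho>0 = indicator {T / 2..T}"
  define \<rho>1 :: "real \<Rightarrow> ennreal" where "\<rho>1 x = ennreal (gauss (\<lambda>_. 1 / N ^ 3) x)" for x
  define \<rho>2 :: "real \<times> real \<Rightarrow> ennreal" where "\<rho>2 q = ennreal (gauss (\<lambda>_. N) q)" for q
  have N0: "N > 0" using N by simp
  have \<rho>: "ennreal (?\<psi> p) = \<rho>1 (fst p) * \<rho>2 (snd p)" for p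
    by (cases p) (simp add: gauss_anisotropy \<rho>1_def \<rho>2_def ennreal_mult gauss_pos less_imp_le)
  have R1: "?R1 > 0" and R2: "?R2 > 0"
    by (rule gauss_integral_pos; simp)+
  have i0: "(\<integral>\<^sup>+t. \<rho>0 t \<partial>lborel) = ennreal (T / 2)"
    using T by (simp add: \<rho>0_def)
  have i1: "(\<integral>\<^sup>+x. (\<rho>1 x)\<^sup>2 \<partial>lborel) = ennreal (N ^ 3 * ?R1)"
  proof -
    have sq: "(\<rho>1 x)\<^sup>2 = ennreal (gauss (\<lambda>_. sqrt 2 * (1 / N ^ 3)) x)" for x
      by (simp add: \<rho>1_def ennreal_power gauss_pos less_imp_le gauss_square)
    have "(\<integral>\<^sup>+x. (\<rho>1 x)\<^sup>2 \<partial>lborel) = ennreal (N ^ 3) * (\<integral>\<^sup>+x. ennreal (gauss (\<lambda>_. sqrt 2) (x::real)) \<partial>lborel)"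
      unfolding sq using N0
      by (subst nn_integral_dilation[of "\<lambda>_. N ^ 3"]) (auto simp: gauss_dilation)
    then show ?thesis
      using R1 N0 by (simp add: nn_integral_eq_integral gauss_integrable gauss_pos less_imp_le ennreal_mult)
  qed
  have i2: "(\<integral>\<^sup>+q. \<rho>2 q \<partial>lborel) = ennreal (?R2 / N\<^sup>2)"
  proof -
    have "(\<integral>\<^sup>+q. \<rho>2 q \<partial>lborel) = ennreal (1 / N\<^sup>2) * (\<integral>\<^sup>+q. ennreal (gauss (\<lambda>_. 1) (q::real \<times> real)) \<partial>lborel)"
      unfolding \<rho>2_def using N0
      by (subst nn_integral_dilation[of "\<lambda>_. 1 / N"]) (auto simp: gauss_dilation power2_eq_square)
    then show ?thesis
      using R2 N0 by (simp add: nn_integral_eq_integral gauss_integrable gauss_pos less_imp_le flip: ennreal_mult)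
  qed
  define k where "k = T / 2 * (?R2 / N\<^sup>2)"
  have k: "(\<integral>\<^sup>+t. \<rho>0 t \<partial>lborel) * (\<integral>\<^sup>+q. \<rho>2 q \<partial>lborel) = ennreal k" "k > 0"
    using T R2 N0 by (simp_all add: i0 i2 k_def flip: ennreal_mult)
  show ?thesis
    unfolding mixed_norm_def
  proof (rule INF_greatest, clarify)
    fix v :: "real \<Rightarrow> R3 \<Rightarrow> complex"
    assume v: "(\<lambda>(t, p). v t p) \<in> borel_measurable lborel"
      and rep: "AE t in lborel. t \<in> {0..T} \<longrightarrow> represents (v t) (?w t)"
    have le: "ennreal ?W \<le> (\<integral>\<^sup>+p. ennreal (norm (v t p)) * (\<rho>1 (fst p) * \<rho>2 (snd p)) \<partial>lborel)"
      if t: "t \<in> {T / 2..T}" and rep: "represents (v t) (?w t)" for t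
    proof -
      have sch: "(\<lambda>p. complex_of_real (?\<psi> p)) \<in> schwartz"
        by (rule gauss_schwartz) (simp add: anisotropy_pos N0)
      have "?W \<le> t powr \<alpha> * norm (U t (gauss_distr (anisotropy N)) (\<lambda>x. of_real (?\<psi> x)))"
      proof -
        let ?I = "N * ((LINT \<zeta>|lborel. gauss (\<lambda>_. sqrt 2) (\<zeta>::R3)) - (LINT \<zeta>|lborel. \<bar>symb \<zeta>\<bar> * gauss (\<lambda>_. sqrt 2) \<zeta>) / N)"
        have "?I \<ge> 0" using W T by (simp add: mult.assoc zero_le_mult_iff)
        then show ?thesis
          unfolding mult.assoc[of _ N]
          using t T \<alpha> norm_U_gauss_ge[OF N, of t] by (intro mult_mono powr_mono2) auto
      qed
      also have "\<dots> = norm (?w t (\<lambda>x. of_real (?\<psi> x)))"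
        by (simp add: norm_mult)
      also have "?w t (\<lambda>x. of_real (?\<psi> x)) = (LINT p|lborel. v t p * of_real (?\<psi> p))"
        using rep sch unfolding represents_def by blast
      finally have "ennreal ?W \<le> ennreal (norm (LINT p|lborel. v t p * of_real (?\<psi> p)))"
        by (rule ennreal_leI)
      also have "\<dots> \<le> (\<integral>\<^sup>+p. ennreal (norm (v t p * of_real (?\<psi> p))) \<partial>lborel)"
        by (rule integral_norm_bound_ennreal) (use rep sch in \<open>simp add: represents_def\<close>)
      also have "\<dots> = (\<integral>\<^sup>+p. ennreal (norm (v t p)) * (\<rho>1 (fst p) * \<rho>2 (snd p)) \<partial>lborel)"
        by (simp add: norm_mult ennreal_mult gauss_pos less_imp_le flip: \<rho>)
      finally show ?thesis .
    qed
    have [measurable]: "\<rho>0 \<in> borel_measurable lborel"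
      by (simp add: \<rho>0_def)
    have "ennreal (T / 2 * ?W) = ennreal (T / 2) * ennreal ?W"
      using T W by (intro ennreal_mult) auto
    also have "\<dots> = (\<integral>\<^sup>+t. \<rho>0 t * ennreal ?W \<partial>lborel)"
      by (subst nn_integral_multc) (simp_all only: i0, measurable)
    also have "\<dots> \<le> (\<integral>\<^sup>+t. \<rho>0 t * (\<integral>\<^sup>+p. ennreal (norm (v t p)) * (\<rho>1 (fst p) * \<rho>2 (snd p)) \<partial>lborel) \<partial>lborel)"
    proof (rule nn_integral_mono_AE)
      show "AE t in lborel. \<rho>0 t * ennreal ?W \<le>
          \<rho>0 t * (\<integral>\<^sup>+p. ennreal (norm (v t p)) * (\<rho>1 (fst p) * \<rho>2 (snd p)) \<partial>lborel)"
        using rep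
      proof eventually_elim
        case (elim t)
        then show ?case
          using le[of t] T by (cases "t \<in> {T / 2..T}") (auto simp: \<rho>0_def)
      qed
    qed
    finally have "(ennreal (T / 2 * ?W))\<^sup>2 \<le>
      (\<integral>\<^sup>+t. \<rho>0 t * (\<integral>\<^sup>+p. ennreal (norm (v t p)) * (\<rho>1 (fst p) * \<rho>2 (snd p)) \<partial>lborel) \<partial>lborel)\<^sup>2"
      by (rule power_mono) simp
    also have "\<dots> \<le> (\<integral>\<^sup>+x. (\<rho>1 x)\<^sup>2 \<partial>lborel) * (ennreal k * L2_Linf_norm T v)\<^sup>2"
    proof (rule weighted_integral_le_L2_Linf_norm[OF v _ _ _ _ k])
      show "\<rho>0 t = 0" if "t \<notin> {0..T}" for t using that T by (auto simp: \<rho>0_def)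
    qed (simp_all add: \<rho>0_def \<rho>1_def[abs_def] \<rho>2_def[abs_def])
    finally have "(ennreal (T / 2 * ?W))\<^sup>2 \<le> ennreal (N ^ 3 * ?R1) * (ennreal k * L2_Linf_norm T v)\<^sup>2"
      by (simp only: i1)
    then have "ennreal (T / 2 * ?W / (sqrt (N ^ 3 * ?R1) * k)) \<le> L2_Linf_norm T v"
      by (rule ennreal_le_of_square_le) (use T W N0 R1 k in simp_all)
    also have "T / 2 * ?W / (sqrt (N ^ 3 * ?R1) * k) = ?W * sqrt N / (sqrt ?R1 * ?R2)"
    proof -
      have "sqrt (N ^ 3) * sqrt N = N\<^sup>2"
        unfolding real_sqrt_mult[symmetric] using N0 by (simp add: power4_eq_xxxx real_sqrt_unique power2_eq_square power3_eq_cube real_sqrt_mult)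
      then have "N\<^sup>2 / sqrt (N ^ 3) = sqrt N"
        using N0 by (simp add: field_simps)
      moreover have "T / 2 * ?W / (sqrt (N ^ 3 * ?R1) * k) = ?W * (N\<^sup>2 / sqrt (N ^ 3)) / (sqrt ?R1 * ?R2)"
        using T by (simp add: k_def real_sqrt_mult)
      ultimately show ?thesis by simp
    qed
    finally show "ennreal (?W * sqrt N / (sqrt ?R1 * ?R2)) \<le> L2_Linf_norm T v" .
  qed
next
  case False
  have "?R1 \<ge> 0" "?R2 \<ge> 0"
    by (intro Bochner_Integration.integral_nonneg; simp add: gauss_pos less_imp_le)+
  moreover have "w * sqrt N / (sqrt a * b) \<le> 0" if "a \<ge> 0" "b \<ge> 0" "\<not> w \<ge> 0" for w a b
    using that N by (intro divide_nonpos_nonneg mult_nonpos_nonneg) auto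
  ultimately have "?W * sqrt N / (sqrt ?R1 * ?R2) \<le> 0"
    using False by blast
  then show ?thesis by (simp add: ennreal_neg)
qed

section \<open>Necessity of one derivative\<close>

theorem proposition3p4:
  fixes T s :: real
  assumes "0 < T" and "T < 1"
    and "\<exists>\<alpha>\<ge>0. \<exists>C>0. \<forall>\<phi>\<in>sobolev s.
           mixed_norm T (\<lambda>t \<psi>. of_real (t powr \<alpha>) * U t \<phi> \<psi>) \<le> ennreal C * sobolev_norm s \<phi>"
  shows "s \<ge> 1"
proof (rule ccontr)
  assume "\<not> s \<ge> 1"
  \<comment> \<open>A nonnegative exponent below 1 that dominates \<open>s\<close>.\<close>
  define \<sigma> where "\<sigma> = max s 0"
  have \<sigma>: "s \<le> \<sigma>" "0 \<le> \<sigma>" "\<sigma> < 1" using \<open>\<not> s \<ge> 1\<close> by (auto simp: \<sigma>_def)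
  obtain \<alpha> C where \<alpha>: "\<alpha> \<ge> 0" and C: "C > 0"
    and est: "\<And>\<phi>. \<phi> \<in> sobolev s \<Longrightarrow>
      mixed_norm T (\<lambda>t \<psi>. of_real (t powr \<alpha>) * U t \<phi> \<psi>) \<le> ennreal C * sobolev_norm s \<phi>"
    using assms(3) by blast
  define K0 where "K0 = (LINT \<zeta>|lborel. gauss (\<lambda>_. sqrt 2) (\<zeta>::R3))"
  define K1 where "K1 = (LINT \<zeta>|lborel. \<bar>symb \<zeta>\<bar> * gauss (\<lambda>_. sqrt 2) \<zeta>)"
  define K2 where "K2 = (LINT \<xi>::R3|lborel. (1 + (norm \<xi>)\<^sup>2) * gauss (\<lambda>_. sqrt 2) \<xi>)"
  define R where "R = sqrt (LINT x|lborel. gauss (\<lambda>_. sqrt 2) (x::real)) * (LINT q|lborel. gauss (\<lambda>_. 1) (q::real \<times> real))"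
  have K0: "K0 > 0"
    unfolding K0_def by (rule gauss_integral_pos) simp
  have R: "R > 0"
    unfolding R_def by (intro mult_pos_pos real_sqrt_gt_zero gauss_integral_pos) simp_all
  have K2: "K2 \<ge> 0"
    unfolding K2_def by (intro Bochner_Integration.integral_nonneg) (simp add: gauss_pos less_imp_le)
  \<comment> \<open>The Sobolev norm contributes \<open>N powr (\<sigma> + 1 / 2)\<close>, the mixed norm \<open>N powr (3 / 2)\<close>.\<close>
  have key: "(T / 2) powr \<alpha> * (K0 - K1 / N) \<le> C * sqrt K2 * R * N powr (\<sigma> - 1)" if N: "N \<ge> 1" for N
  proof -
    have N0: "N > 0" using N by simp
    have "sobolev_norm s (gauss_distr (anisotropy N)) \<le> ennreal (N powr \<sigma> * sqrt (K2 / (\<Prod>b\<in>Basis. anisotropy N b)))"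
      unfolding K2_def using \<sigma> N
      by (intro gauss_distr_sobolev_norm) (auto simp: anisotropy_pos anisotropy_le)
    then have sob: "sobolev_norm s (gauss_distr (anisotropy N)) \<le> ennreal (N powr \<sigma> * sqrt (K2 * N))"
      using N by (simp add: prod_anisotropy)
    moreover have "tempered_distr (gauss_distr (anisotropy N))"
      using N by (intro gauss_distr_tempered) (simp add: anisotropy_pos)
    ultimately have "gauss_distr (anisotropy N) \<in> sobolev s"
      by (auto simp: sobolev_def intro: le_less_trans)
    from est[OF this] have "ennreal ((T / 2) powr \<alpha> * N * (K0 - K1 / N) * sqrt N / R) \<le>
        ennreal C * sobolev_norm s (gauss_distr (anisotropy N))"
      using mixed_norm_U_gauss_ge[OF assms(1,2) \<alpha> N] unfolding K0_def K1_def R_def by (rule order_trans[rotated])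
    also have "\<dots> \<le> ennreal C * ennreal (N powr \<sigma> * sqrt (K2 * N))"
      using sob by (rule mult_left_mono) simp
    also have "\<dots> = ennreal (C * (N powr \<sigma> * sqrt (K2 * N)))"
      using C by (simp add: ennreal_mult')
    finally have "(T / 2) powr \<alpha> * N * (K0 - K1 / N) * sqrt N / R \<le> C * (N powr \<sigma> * sqrt (K2 * N))"
      using C K2 N by (subst (asm) ennreal_le_iff) auto
    then have "((T / 2) powr \<alpha> * (K0 - K1 / N)) * (N * sqrt N) \<le> (C * sqrt K2 * R * N powr (\<sigma> - 1)) * (N * sqrt N)"
      using R N by (simp add: pos_divide_le_eq real_sqrt_mult powr_diff mult_ac)
    then show ?thesis using N by simp
  qed
  have lim1: "((\<lambda>N. (T / 2) powr \<alpha> * (K0 - K1 / N)) \<longlongrightarrow> (T / 2) powr \<alpha> * (K0 - 0)) at_top"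
    by (intro tendsto_intros real_tendsto_divide_at_top[OF tendsto_const filterlim_ident])
  have lim2: "((\<lambda>N. C * sqrt K2 * R * N powr (\<sigma> - 1)) \<longlongrightarrow> C * sqrt K2 * R * 0) at_top"
    using \<sigma> by (intro tendsto_mult tendsto_const tendsto_neg_powr filterlim_ident) auto
  have "(T / 2) powr \<alpha> * (K0 - 0) \<le> C * sqrt K2 * R * 0"
  proof (rule tendsto_le[OF trivial_limit_at_top_linorder lim2 lim1])
    show "\<forall>\<^sub>F N in at_top. (T / 2) powr \<alpha> * (K0 - K1 / N) \<le> C * sqrt K2 * R * N powr (\<sigma> - 1)"
      using eventually_ge_at_top[of 1] by eventually_elim (rule key)
  qed
  with K0 assms(1) show False by (simp add: mult_le_0_iff)
qed

end
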